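(* Consider the spatially discretized ideal vorticity–potential system in which the potential $\varphi\in H^1_p(\tau_h)$ is determined from the vorticity $w$ by $$\int_\Omega \frac{\rho}{B^2}\,\nabla_\perp\psi\cdot\nabla_\perp\varphi\,dV=\int_\Omega\psi\,w\,dV+\int_{\partial\Omega}\psi\,\frac{\rho}{B^2}\,\nabla_\perp\varphi\cdot\vec n_{\partial\Omega}\,dS\qquad\forall\,\psi\in H^1_p(\tau_h)$$ with a set of boundary conditions that make $\varphi$ unique, and the velocity is $\vec v=\frac{\hat b}{B}\times\nabla_\perp\varphi\in H^{\mathrm{Div}}(\tau_h)$. Assume: (i) for some $\tilde p\ge p$, either $w\in H^1_{\tilde p}(\tau_h)$ is governed by $$\int_\Omega \psi\,(\partial_t w+\vec v\cdot\nabla w)\,dV=0\qquad\forall\,\psi\in H^1_{\tilde p}(\tau_h),$$ or $w\in L^2_{\tilde p}(\tau_h)$ is governed, with some $\delta\in[0,1/2]$, by $$\int_\Omega \eta\,(\partial_t w+\vec v\cdot\nabla w)\,dV-\int_\Gamma\Big[(\vec v\cdot\vec n_\Gamma)\,\{\eta\}\,[\![w]\!]-\delta\,|\vec v\cdot\vec n_\Gamma|\,[\![\eta]\!]\,[\![w]\!]\Big]dS=0\qquad\forall\,\eta\in L^2_{\tilde p}(\tau_h);$$ (ii) $\nabla\cdot\vec v=0$ in $\Omega$; (iii) periodic or homogeneous Dirichlet boundary conditions (or a mixture thereof) hold for $w$ and $\varphi$. If the resulting ODE system for the coefficients of $w$ is evolved in discrete time with a symplectic integrator, then energy is conserved in discrete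 time: the iterates $w_0,w_1,\dots$ with associated potentials $\varphi_0,\varphi_1,\dots$ satisfy $$\tfrac12\int_\Omega\frac{\rho}{B^2}\,|\nabla_\perp\varphi_{n+1}|^2\,dV=\tfrac12\int_\Omega\frac{\rho}{B^2}\,|\nabla_\perp\varphi_{n}|^2\,dV\qquad\text{for all } n.$$
   Context: $\Omega$ is a bounded polygonal/polyhedral domain with outward unit normal $\vec n_{\partial\Omega}$ (in the two-dimensional case, vector fields are regarded as three-dimensional fields independent of the third coordinate $z$), and $\tau_h$ is a conforming finite element mesh of $\Omega$ with cells $K$. $\Gamma$ is the union of the internal faces between cells (periodically identified boundary faces count as internal faces), and $\vec n_\Gamma$ is a fixed unit normal on each face of $\Gamma$. For a piecewise smooth $\eta$, let $\eta^+$ and $\eta^-$ be the one-sided values on $\Gamma$ from the upwind side (the side $\vec n_\Gamma$ points out of) and the downwind side (the side $\vec n_\Gamma$ points into), respectively. The jump and average are $[\![\eta]\!]=\eta^+-\eta^-$ and $\{\eta\}=(\eta^++\eta^-)/2$. Spaces: $L^2_{q}(\tau_h)$ is the space of functions that are polynomial of order $\le q$ on each cell, possibly discontinuous across $\Gamma$; $H^1_{q}(\tau_h)$ is the subspace of continuous ones; $H^{\mathrm{Div}}(\tau_h)$ is the space of piecewise polynomial vector fields whose normal component is continuous across $\Gamma$. Derivatives are taken cell by cell. The boundary conditions on $w$ and $\varphi$ (on the same parts of the boundary) are built into the trial and test spaces, i.e. $H^1_p(\tau_h)$, $H^1_{\tilde p}(\tau_h)$ and $L^2_{\tilde p}(\tau_h)$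 denote the corresponding subspaces satisfying these conditions. In the purely periodic case the trial and test space for $\varphi$ additionally carries a normalization (e.g. zero mean). Uniqueness of $\varphi$ means that the quadratic form $\psi\mapsto\int_\Omega\frac{\rho}{B^2}|\nabla_\perp\psi|^2dV$ is positive definite on the potential space; thus $\varphi$ is a linear function of $w$. Data: $\rho>0$ is the mass density, $\vec B$ the magnetic field, $B=|\vec B|>0$ its magnitude and $\hat b=\vec B/B$ its direction; all are time-independent. $\nabla_\perp=\nabla-\hat b\,(\hat b\cdot\nabla)$ is the gradient component perpendicular to $\hat b$. Assumption (ii) is understood for every velocity entering the scheme, including at intermediate stages. Expanding $w$ in a basis turns the system into an autonomous ODE $\dot{\boldsymbol w}=\boldsymbol f(\boldsymbol w)$ for the coefficient vector (the mass matrix is invertible). A symplectic integrator means a symplectic Runge–Kutta method, i.e. one whose coefficients $(a_{ij}),(b_i)$ satisfy $b_ia_{ij}+b_ja_{ji}=b_ib_j$ for all $i,j$ (for example, Gauss–Legendre methods such as the implicit midpoint rule), with the stage equations solved exactly (solutions of the stage equations are assumed to exist). *)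

theory Defs
  imports "HOL-Analysis.Analysis"
begin

text \<open>
  A piecewise smooth field is given by its restrictions to the closed cells: \<open>f K\<close> is the
  restriction to the cell \<open>K\<close>, extended up to the faces of \<open>K\<close>. The one-sided values on a face
  of \<open>K\<close> are therefore the values of \<open>f K\<close>, and cell-by-cell derivatives are derivatives of
  \<open>f K\<close> at points of \<open>K\<close>.
\<close>

type_synonym ('n, 'b) pw = "(real^'n) set \<Rightarrow> real^'n \<Rightarrow> 'b"


section \<open>Meshes\<close>

text \<open>
  \<open>pfaces\<close> are the periodically identified boundary faces; the face \<open>F\<close> is identified with its
  translate by \<open>pshift F\<close>. \<open>fnormal\<close> is the normal chosen on each face of \<open>\<Gamma>\<close>.
\<close>

record 'n mesh =
  cells :: "(real^'n) set set"
  pfaces :: "(real^'n) set set"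
  pshift :: "(real^'n) set \<Rightarrow> real^'n"
  fnormal :: "(real^'n) set \<Rightarrow> real^'n"

definition translate :: "real^'n \<Rightarrow> (real^'n) set \<Rightarrow> (real^'n) set" where
  "translate s F = (\<lambda>x. x + s) ` F"

definition outward_normal :: "(real^'n) set \<Rightarrow> (real^'n) set \<Rightarrow> real^'n" where
  "outward_normal K F =
     (THE \<nu>. norm \<nu> = 1 \<and> (\<exists>c. K \<subseteq> {x. \<nu> \<bullet> x \<le> c} \<and> F = K \<inter> {x. \<nu> \<bullet> x = c}))"

definition conforming_mesh :: "(real^'n) set \<Rightarrow> (real^'n) set set \<Rightarrow> bool" where
  "conforming_mesh \<Omega> T \<longleftrightarrow>
     finite T \<and> (\<forall>K\<in>T. polytope K \<and> interior K \<noteq> {}) \<and>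
     (\<forall>K\<in>T. \<forall>K'\<in>T. K \<noteq> K' \<longrightarrow>
        interior K \<inter> interior K' = {} \<and> (K \<inter> K') face_of K \<and> (K \<inter> K') face_of K') \<and>
     \<Union>T = closure \<Omega>"

text \<open>The condition \<open>interior (closure \<Omega>) = \<Omega>\<close> excludes slits, so that a face shared by two cells is never on \<open>\<partial>\<Omega>\<close>.\<close>

definition bounded_domain :: "(real^'n) set \<Rightarrow> bool" where
  "bounded_domain \<Omega> \<longleftrightarrow> open \<Omega> \<and> connected \<Omega> \<and> \<Omega> \<noteq> {} \<and> bounded \<Omega> \<and> interior (closure \<Omega>) = \<Omega>"

definition outer_faces :: "('n::finite) mesh \<Rightarrow> ((real^'n) set \<times> (real^'n) set) set" where
  "outer_faces M = {(K, F). K \<in> cells M \<and> F facet_of K \<and> (\<forall>K'\<in>cells M. F facet_of K' \<longrightarrow> K' = K)}"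

text \<open>
  Periodically identified faces count as internal, so that \<open>\<partial>\<Omega>\<close> consists of the remaining outer
  faces. These are exactly the faces that carry the Dirichlet condition.
\<close>

definition boundary_faces :: "('n::finite) mesh \<Rightarrow> ((real^'n) set \<times> (real^'n) set) set" where
  "boundary_faces M = {(K, F) \<in> outer_faces M. F \<notin> pfaces M}"

definition periodic_identification :: "('n::finite) mesh \<Rightarrow> bool" where
  "periodic_identification M \<longleftrightarrow>
     (\<forall>F\<in>pfaces M. \<exists>K. (K, F) \<in> outer_faces M) \<and>
     (\<forall>F\<in>pfaces M. let F' = translate (pshift M F) F in
        F' \<in> pfaces M \<and> pshift M F' = - pshift M F \<and>
        (\<forall>K K'. (K, F) \<in> outer_faces M \<longrightarrow> (K', F') \<in> outer_faces M \<longrightarrow>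
           outward_normal K' F' = - outward_normal K F))"

text \<open>
  \<open>(K, F, K', s)\<close> is an internal face with a choice of its two sides: \<open>F\<close> as a face of \<open>K\<close>, and
  \<open>translate s F\<close> as a face of \<open>K'\<close>, where \<open>s = 0\<close> unless the face is periodic. Each internal
  face occurs twice, once for each order of the sides.
\<close>

definition interfaces ::
  "('n::finite) mesh \<Rightarrow> ((real^'n) set \<times> (real^'n) set \<times> (real^'n) set \<times> (real^'n)) set" where
  "interfaces M = {(K, F, K', s). K \<in> cells M \<and> K' \<in> cells M \<and>
     F facet_of K \<and> translate s F facet_of K' \<and>
     (K \<noteq> K' \<and> s = 0 \<or> F \<in> pfaces M \<and> s = pshift M F)}"

definition oriented :: "('n::finite) mesh \<Rightarrow> bool" where
  "oriented M \<longleftrightarrow> (\<forall>(K, F, K', s)\<in>interfaces M.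
     (fnormal M F = outward_normal K F \<or> fnormal M F = - outward_normal K F) \<and>
     fnormal M (translate s F) = fnormal M F)"

text \<open>
  Of the two orders of the sides, \<open>\<Gamma>\<close> keeps the one in which the normal points out of \<open>K\<close> and
  into \<open>K'\<close>: \<open>K\<close> is the \<open>+\<close> side and \<open>K'\<close> the \<open>-\<close> side.
\<close>

definition \<Gamma> ::
  "('n::finite) mesh \<Rightarrow> ((real^'n) set \<times> (real^'n) set \<times> (real^'n) set \<times> (real^'n)) set" where
  "\<Gamma> M = {(K, F, K', s) \<in> interfaces M. fnormal M F = outward_normal K F}"

definition fe_mesh :: "(real^'n) set \<Rightarrow> ('n::finite) mesh \<Rightarrow> bool" where
  "fe_mesh \<Omega> M \<longleftrightarrow> bounded_domain \<Omega> \<and> conforming_mesh \<Omega> (cells M) \<and>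
     periodic_identification M \<and> oriented M"


section \<open>Integrals\<close>

definition vol_int :: "('n::finite) mesh \<Rightarrow> ('n, real) pw \<Rightarrow> real" where
  "vol_int M f = (\<Sum>K\<in>cells M. LINT x:K|lborel. f K x)"

text \<open>
  Surface integral over a flat face \<open>F\<close> with unit normal \<open>\<nu>\<close>: by Fubini it is the volume integral
  over the prism of height one erected on \<open>F\<close>, with the integrand constant along \<open>\<nu>\<close>. The map
  \<open>closest_point (affine hull F)\<close> is the orthogonal projection back to the plane of \<open>F\<close>.
\<close>

definition face_int :: "real^'n \<Rightarrow> (real^'n) set \<Rightarrow> (real^'n \<Rightarrow> real) \<Rightarrow> real" where
  "face_int \<nu> F g =
     (LINT y:{x + t *\<^sub>R \<nu> | x t. x \<in> F \<and> 0 \<le> t \<and> t \<le> 1}|lborel. g (closest_point (affine hull F) y))"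


section \<open>Finite element spaces\<close>

definition poly_le :: "nat \<Rightarrow> (real^'n \<Rightarrow> real) \<Rightarrow> bool" where
  "poly_le q f \<longleftrightarrow> (\<exists>c. \<forall>x.
     f x = (\<Sum>\<alpha> | (\<Sum>i\<in>UNIV. \<alpha> i) \<le> q. c \<alpha> * (\<Prod>i\<in>UNIV. (x $ i) ^ (\<alpha> i :: nat))))"

text \<open>
  The spaces with the boundary conditions built in. Setting \<open>f K = 0\<close> for sets \<open>K\<close> that are not
  cells makes the representation of a piecewise polynomial unique.
\<close>

definition L2_space :: "('n::finite) mesh \<Rightarrow> nat \<Rightarrow> ('n, real) pw set" where
  "L2_space M q = {f.
     (\<forall>K\<in>cells M. poly_le q (f K)) \<and> (\<forall>K. K \<notin> cells M \<longrightarrow> f K = (\<lambda>x. 0)) \<and>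
     (\<forall>(K, F)\<in>boundary_faces M. \<forall>x\<in>F. f K x = 0)}"

definition H1_space :: "('n::finite) mesh \<Rightarrow> nat \<Rightarrow> ('n, real) pw set" where
  "H1_space M q = {f \<in> L2_space M q. \<forall>(K, F, K', s)\<in>interfaces M. \<forall>x\<in>F. f K x = f K' (x + s)}"

definition linear_functional_on :: "('n, real) pw set \<Rightarrow> (('n, real) pw \<Rightarrow> real) \<Rightarrow> bool" where
  "linear_functional_on S N \<longleftrightarrow>
     (\<forall>f\<in>S. \<forall>g\<in>S. \<forall>a b. N (\<lambda>K x. a * f K x + b * g K x) = a * N f + b * N g)"

text \<open>
  Trial and test space of the potential. The normalization \<open>N \<psi> = 0\<close>, for example zero mean with
  \<open>N = vol_int M\<close>, is imposed only if there is no Dirichlet boundary.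
\<close>

definition potential_space ::
  "('n::finite) mesh \<Rightarrow> nat \<Rightarrow> (('n, real) pw \<Rightarrow> real) \<Rightarrow> ('n, real) pw set" where
  "potential_space M p N = {\<psi> \<in> H1_space M p. boundary_faces M = {} \<longrightarrow> N \<psi> = 0}"

definition lincomb :: "nat \<Rightarrow> (nat \<Rightarrow> ('n, real) pw) \<Rightarrow> (nat \<Rightarrow> real) \<Rightarrow> ('n, real) pw" where
  "lincomb m e c = (\<lambda>K x. \<Sum>j<m. c j * e j K x)"

definition is_basis :: "('n, real) pw set \<Rightarrow> nat \<Rightarrow> (nat \<Rightarrow> ('n, real) pw) \<Rightarrow> bool" where
  "is_basis S m e \<longleftrightarrow>
     (\<forall>j<m. e j \<in> S) \<and> (\<forall>f\<in>S. \<exists>c. f = lincomb m e c) \<and>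
     (\<forall>c. lincomb m e c = (\<lambda>K x. 0) \<longrightarrow> (\<forall>j<m. c j = 0))"


section \<open>Fields and differential operators\<close>

text \<open>
  \<open>emb\<close> is a linear isometry that places the coordinate space in \<open>real^3\<close>, for example the
  identity in three dimensions and \<open>(x, y) \<mapsto> (x, y, 0)\<close> in two dimensions. Vector fields always
  have three components; in two dimensions they do not depend on the third coordinate, so their
  derivatives are taken along the range of \<open>emb\<close> only.
\<close>

record 'n medium =
  emb :: "real^'n \<Rightarrow> real^3"
  rho :: "('n, real) pw"
  mag :: "('n, real^3) pw"

definition medium_on :: "('n::finite) mesh \<Rightarrow> 'n medium \<Rightarrow> bool" where
  "medium_on M D \<longleftrightarrow>
     linear (emb D) \<and> (\<forall>x. norm (emb D x) = norm x) \<and>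
     (\<forall>K\<in>cells M. continuous_on K (rho D K) \<and> continuous_on K (mag D K) \<and>
        (\<forall>x\<in>K. rho D K x > 0 \<and> mag D K x \<noteq> 0))"

definition bhat :: "('n::finite) medium \<Rightarrow> ('n, real^3) pw" where
  "bhat D K x = mag D K x /\<^sub>R norm (mag D K x)"

definition grad :: "('n::finite) medium \<Rightarrow> ('n, real) pw \<Rightarrow> ('n, real^3) pw" where
  "grad D f K x = (\<Sum>i\<in>UNIV. frechet_derivative (f K) (at x) (axis i 1) *\<^sub>R emb D (axis i 1))"

definition grad_perp :: "('n::finite) medium \<Rightarrow> ('n, real) pw \<Rightarrow> ('n, real^3) pw" where
  "grad_perp D f K x = grad D f K x - (bhat D K x \<bullet> grad D f K x) *\<^sub>R bhat D K x"

definition divergence :: "('n::finite) medium \<Rightarrow> ('n, real^3) pw \<Rightarrow> ('n, real) pw" where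
  "divergence D v K x = (\<Sum>i\<in>UNIV. frechet_derivative (v K) (at x) (axis i 1) \<bullet> emb D (axis i 1))"

definition velocity :: "('n::finite) medium \<Rightarrow> ('n, real) pw \<Rightarrow> ('n, real^3) pw" where
  "velocity D \<phi> K x = cross3 (bhat D K x /\<^sub>R norm (mag D K x)) (grad_perp D \<phi> K x)"

definition H_Div :: "('n::finite) mesh \<Rightarrow> 'n medium \<Rightarrow> ('n, real^3) pw set" where
  "H_Div M D = {v.
     (\<forall>K\<in>cells M. \<exists>P. polynomial_function P \<and> (\<forall>x\<in>K. v K x = P x)) \<and>
     (\<forall>(K, F, K', s)\<in>interfaces M. \<forall>x\<in>F.
        v K x \<bullet> emb D (fnormal M F) = v K' (x + s) \<bullet> emb D (fnormal M F))}"

definition divergence_free :: "('n::finite) mesh \<Rightarrow> 'n medium \<Rightarrow> ('n, real^3) pw \<Rightarrow> bool" where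
  "divergence_free M D v \<longleftrightarrow> (\<forall>K\<in>cells M. \<forall>x\<in>interior K. divergence D v K x = 0)"


section \<open>The spatially discretized system\<close>

definition energy :: "('n::finite) mesh \<Rightarrow> 'n medium \<Rightarrow> ('n, real) pw \<Rightarrow> real" where
  "energy M D \<phi> = 1/2 * vol_int M (\<lambda>K x.
     rho D K x / (norm (mag D K x))\<^sup>2 * (norm (grad_perp D \<phi> K x))\<^sup>2)"

definition pos_definite_on :: "('n::finite) mesh \<Rightarrow> 'n medium \<Rightarrow> ('n, real) pw set \<Rightarrow> bool" where
  "pos_definite_on M D V \<longleftrightarrow> (\<forall>\<psi>\<in>V. \<psi> \<noteq> (\<lambda>K x. 0) \<longrightarrow>
     vol_int M (\<lambda>K x. rho D K x / (norm (mag D K x))\<^sup>2 * (norm (grad_perp D \<psi> K x))\<^sup>2) > 0)"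

definition solves_potential_eq ::
  "('n::finite) mesh \<Rightarrow> 'n medium \<Rightarrow> ('n, real) pw set \<Rightarrow> ('n, real) pw \<Rightarrow> ('n, real) pw \<Rightarrow> bool" where
  "solves_potential_eq M D V w \<phi> \<longleftrightarrow> \<phi> \<in> V \<and> (\<forall>\<psi>\<in>V.
     vol_int M (\<lambda>K x. rho D K x / (norm (mag D K x))\<^sup>2 * (grad_perp D \<psi> K x \<bullet> grad_perp D \<phi> K x)) =
     vol_int M (\<lambda>K x. \<psi> K x * w K x) +
     (\<Sum>(K, F)\<in>boundary_faces M. face_int (outward_normal K F) F (\<lambda>x.
        \<psi> K x * (rho D K x / (norm (mag D K x))\<^sup>2) *
        (grad_perp D \<phi> K x \<bullet> emb D (outward_normal K F)))))"

text \<open>In the next two definitions \<open>wt\<close> stands for \<open>\<partial>\<^sub>t w\<close>.\<close>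

definition cg_vorticity_eq ::
  "('n::finite) mesh \<Rightarrow> 'n medium \<Rightarrow> ('n, real) pw set \<Rightarrow>
   ('n, real^3) pw \<Rightarrow> ('n, real) pw \<Rightarrow> ('n, real) pw \<Rightarrow> bool" where
  "cg_vorticity_eq M D W v w wt \<longleftrightarrow> (\<forall>\<psi>\<in>W.
     vol_int M (\<lambda>K x. \<psi> K x * (wt K x + v K x \<bullet> grad D w K x)) = 0)"

text \<open>
  The normal velocity is taken from the \<open>+\<close> side; for \<open>v \<in> H_Div M D\<close> the choice does not matter.
\<close>

definition dg_vorticity_eq ::
  "('n::finite) mesh \<Rightarrow> 'n medium \<Rightarrow> ('n, real) pw set \<Rightarrow> real \<Rightarrow>
   ('n, real^3) pw \<Rightarrow> ('n, real) pw \<Rightarrow> ('n, real) pw \<Rightarrow> bool" where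
  "dg_vorticity_eq M D W \<delta> v w wt \<longleftrightarrow> (\<forall>\<eta>\<in>W.
     vol_int M (\<lambda>K x. \<eta> K x * (wt K x + v K x \<bullet> grad D w K x)) -
     (\<Sum>(K, F, K', s)\<in>\<Gamma> M. face_int (fnormal M F) F (\<lambda>x.
        let vn = v K x \<bullet> emb D (fnormal M F);
            avg_\<eta> = (\<eta> K x + \<eta> K' (x + s)) / 2;
            jump_\<eta> = \<eta> K x - \<eta> K' (x + s);
            jump_w = w K x - w K' (x + s)
        in vn * avg_\<eta> * jump_w - \<delta> * \<bar>vn\<bar> * jump_\<eta> * jump_w)) = 0)"


section \<open>Runge--Kutta methods\<close>

definition symplectic_RK :: "nat \<Rightarrow> (nat \<Rightarrow> nat \<Rightarrow> real) \<Rightarrow> (nat \<Rightarrow> real) \<Rightarrow> bool" where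
  "symplectic_RK s a b \<longleftrightarrow> (\<forall>i<s. \<forall>j<s. b i * a i j + b j * a j i = b i * b j)"

text \<open>
  One step of size \<open>h\<close> for \<open>c' = f c\<close>, where \<open>c\<close> has the components \<open>c 0, \<dots>, c (m - 1)\<close>; \<open>X i\<close> are
  the stage values.
\<close>

definition RK_step ::
  "nat \<Rightarrow> nat \<Rightarrow> (nat \<Rightarrow> nat \<Rightarrow> real) \<Rightarrow> (nat \<Rightarrow> real) \<Rightarrow> real \<Rightarrow> ((nat \<Rightarrow> real) \<Rightarrow> nat \<Rightarrow> real) \<Rightarrow>
   (nat \<Rightarrow> nat \<Rightarrow> real) \<Rightarrow> (nat \<Rightarrow> real) \<Rightarrow> (nat \<Rightarrow> real) \<Rightarrow> bool" where
  "RK_step m s a b h f X c c' \<longleftrightarrow>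
     (\<forall>i<s. \<forall>k<m. X i k = c k + h * (\<Sum>j<s. a i j * f (X j) k)) \<and>
     (\<forall>k<m. c' k = c k + h * (\<Sum>i<s. b i * f (X i) k))"

end

theory Submission
  imports Defs
begin

text \<open>
  By the potential equation, \<open>\<integral> \<phi>(u) u'\<close> equals the symmetric form
  \<open>\<integral> (\<rho>/B\<^sup>2) \<nabla>\<^sub>\<bottom> \<phi>(u) \<bullet> \<nabla>\<^sub>\<bottom> \<phi>(u')\<close>; it is linear in \<open>u'\<close>, hence bilinear, and the energy is half of
  its diagonal. Symplectic Runge--Kutta methods preserve such a quadratic form as soon as
  \<open>\<integral> \<phi> \<partial>\<^sub>t w = 0\<close> at every stage. Testing the vorticity equation with the continuous function
  \<open>\<phi>\<close> reduces this to \<open>\<phi> v \<bullet> \<nabla>w = div (\<phi> w v)\<close>, which holds in each cell because \<open>v\<close> is divergence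
  free and orthogonal to \<open>\<nabla>\<phi>\<close>, and to the divergence theorem: the resulting face integrals of
  \<open>\<phi> [w] v \<bullet> n\<close> cancel those of the scheme, since \<open>[\<phi>] = 0\<close>.

  The divergence theorem on a polytope \<open>K\<close> follows by sweeping \<open>K\<close> along a segment \<open>[0, t] d\<close>. Up to
  null sets the swept region is the disjoint union of \<open>K\<close> and of the oblique prisms over the facets
  facing \<open>d\<close>, and also of \<open>K + t d\<close> and the prisms over the facets facing \<open>-d\<close>. Comparing both
  decompositions, dividing by \<open>t\<close> and letting \<open>t\<close> tend to \<open>0\<close> gives the claim.
\<close>

section \<open>Rank-one changes of variables\<close>

text \<open>Facet integrals are volume integrals over straight prisms of height one, whereas
  sweeping produces oblique prisms that shrink with \<open>t\<close>. A map that fixes the plane of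
  the facet and sends its normal to \<open>t d\<close> identifies the two. It is the identity plus a
  rank-one map, with Jacobian \<open>t (\<nu> \<bullet> d)\<close>; this is why rank-one changes of
  variables come first. As \<open>t\<close> tends to 0 the map degenerates to the orthogonal
  projection in the definition of \<open>face_int\<close>, so no surface measure has to be
  constructed. The fields are polynomial on each cell, and difference quotients of polynomials
  extend continuously to step 0. Limits therefore pass under the integrals by a uniform bound on a
  compact set. Vector fields have three components even on a planar mesh. The scalar result is
  applied along each coordinate axis, and linearity of \<open>emb\<close> reassembles the flux. Face
  terms of different cells are matched by recording every internal face once from each side and
  pairing the two records by an involution.\<close>

text \<open>
  The library states linear changes of variables on \<open>real^'m\<close> only for a well-ordered index type;
  the copy \<open>'n windex\<close> of \<open>'n\<close> transfers them to arbitrary finite index types.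
\<close>

typedef ('a::finite) windex = "UNIV :: 'a set"
  morphisms of_windex to_windex by simp

lemma bij_of_windex: "bij (of_windex :: 'a::finite windex \<Rightarrow> 'a)"
  by (metis bijI' of_windex_inject to_windex_inverse UNIV_I)

instance windex :: (finite) finite
proof
  have "finite (of_windex -` (UNIV :: 'a set))"
    by (intro finite_vimageI) (auto simp: bij_is_inj[OF bij_of_windex])
  then show "finite (UNIV :: 'a windex set)" by simp
qed

instantiation windex :: (finite) wellorder
begin

text \<open>An arbitrary numbering, which exists because the type is finite; the order pulled back
  from the naturals is then a well-order.\<close>

definition windex_code :: "'a windex \<Rightarrow> nat" where
  "windex_code = (SOME g. inj g)"

definition less_eq_windex :: "'a windex \<Rightarrow> 'a windex \<Rightarrow> bool" where
  "less_eq_windex x y \<longleftrightarrow> windex_code x \<le> windex_code y"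

definition less_windex :: "'a windex \<Rightarrow> 'a windex \<Rightarrow> bool" where
  "less_windex x y \<longleftrightarrow> windex_code x < windex_code y"

lemma windex_code_eq_iff: "windex_code x = windex_code y \<longleftrightarrow> x = y"
proof -
  obtain g :: "'a windex \<Rightarrow> nat" where "inj g"
    using finite_imp_inj_to_nat_seg[OF finite_class.finite_UNIV[where 'a = "'a windex"]] by metis
  then have "inj (windex_code :: 'a windex \<Rightarrow> nat)"
    unfolding windex_code_def by (rule someI[where P = inj])
  then show ?thesis
    by (rule inj_eq)
qed

instance
proof
  fix P :: "'a windex \<Rightarrow> bool" and x
  assume *: "\<And>x. (\<And>y. y < x \<Longrightarrow> P y) \<Longrightarrow> P x"
  show "P x"
  proof (induction "windex_code x" arbitrary: x rule: less_induct)
    case less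
    show ?case
      by (rule *, rule less) (simp add: less_windex_def)
  qed
qed (auto simp: less_eq_windex_def less_windex_def windex_code_eq_iff[symmetric])

end

lemma all_bij_iff:
  assumes "bij \<sigma>"
  shows "(\<forall>i. P (\<sigma> i)) \<longleftrightarrow> (\<forall>j. P j)"
  using assms by (metis bij_pointE)

lemma prod_Basis_vec:
  fixes v :: "real^'n"
  shows "(\<Prod>b\<in>Basis. v \<bullet> b) = (\<Prod>i\<in>UNIV. v $ i)"
proof -
  have "Basis = range (\<lambda>i::'n. axis i (1::real))"
    by (auto simp: Basis_vec_def)
  moreover have "inj (\<lambda>i::'n. axis i (1::real))"
    by (auto simp: inj_on_def axis_eq_axis)
  ultimately have "(\<Prod>b\<in>Basis. v \<bullet> b) = (\<Prod>i\<in>UNIV. v \<bullet> axis i 1)"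
    using prod.reindex[of "\<lambda>i::'n. axis i (1::real)" UNIV "\<lambda>b. v \<bullet> b"] by simp
  then show ?thesis
    by (simp add: inner_axis)
qed

text \<open>Permuting coordinates sends a box to a box with the same side lengths in another order,
  and Lebesgue measure is determined by its values on boxes.\<close>

lemma integral_lborel_reindex:
  fixes g :: "real^'m \<Rightarrow> real" and \<sigma> :: "'m \<Rightarrow> 'n::finite"
  assumes \<sigma>: "bij \<sigma>" and [measurable]: "g \<in> borel_measurable borel"
  shows "(\<integral>y. g y \<partial>lborel) = (\<integral>x. g (\<chi> i. x $ \<sigma> i) \<partial>lborel)"
proof -
  define R :: "real^'n \<Rightarrow> real^'m" where "R = (\<lambda>x. \<chi> i. x $ \<sigma> i)"
  have R[measurable]: "R \<in> borel_measurable borel"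
    unfolding R_def
    by (intro borel_measurable_continuous_onI continuous_intros)
  have inv: "\<sigma> (inv \<sigma> j) = j" "inv \<sigma> (\<sigma> i) = i" for i j
    using \<sigma> by (simp_all add: bij_is_surj surj_f_inv_f bij_is_inj)
  have "lborel = distr lborel borel R"
  proof (rule lborel_eqI)
    fix l u :: "real^'m"
    assume le: "\<And>b. b \<in> Basis \<Longrightarrow> l \<bullet> b \<le> u \<bullet> b"
    define l' u' where "l' = (\<chi> j. l $ inv \<sigma> j)" and "u' = (\<chi> j. u $ inv \<sigma> j)"
    have le': "l $ i \<le> u $ i" for i
      using le[of "axis i 1"] by (auto simp: inner_axis Basis_vec_def)
    have box: "R -` box l u = box l' u'"
    proof (rule set_eqI)
      fix x
      have "x \<in> R -` box l u \<longleftrightarrow>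
          (\<forall>i. l $ inv \<sigma> (\<sigma> i) < x $ \<sigma> i \<and> x $ \<sigma> i < u $ inv \<sigma> (\<sigma> i))"
        by (simp add: R_def mem_box_cart inv)
      also have "\<dots> \<longleftrightarrow> (\<forall>j. l $ inv \<sigma> j < x $ j \<and> x $ j < u $ inv \<sigma> j)"
        by (rule all_bij_iff[OF \<sigma>])
      finally show "x \<in> R -` box l u \<longleftrightarrow> x \<in> box l' u'"
        by (simp add: mem_box_cart l'_def u'_def)
    qed
    have "emeasure (distr lborel borel R) (box l u) = emeasure lborel (box l' u')"
      by (simp add: emeasure_distr box)
    also have "\<dots> = ennreal (\<Prod>b\<in>Basis. (u' - l') \<bullet> b)"
      by (rule emeasure_lborel_box)
         (auto simp: Basis_vec_def inner_axis l'_def u'_def le')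
    also have "(\<Prod>b\<in>Basis. (u' - l') \<bullet> b) = (\<Prod>j\<in>UNIV. u $ inv \<sigma> j - l $ inv \<sigma> j)"
      by (simp add: prod_Basis_vec l'_def u'_def)
    also have "\<dots> = (\<Prod>i\<in>UNIV. u $ i - l $ i)"
      by (rule prod.reindex_bij_betw) (use bij_imp_bij_inv[OF \<sigma>] in simp)
    also have "\<dots> = (\<Prod>b\<in>Basis. (u - l) \<bullet> b)"
      by (simp add: prod_Basis_vec)
    finally show "emeasure (distr lborel borel R) (box l u) = (\<Prod>b\<in>Basis. (u - l) \<bullet> b)" .
  qed simp
  then have "(\<integral>y. g y \<partial>lborel) = (\<integral>y. g y \<partial>distr lborel borel R)"
    by (rule arg_cong)
  also have "\<dots> = (\<integral>x. g (R x) \<partial>lborel)"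
    by (subst integral_distr) simp_all
  finally show ?thesis
    by (simp add: R_def)
qed

text \<open>The matrix determinant lemma. An orthogonal map taking the \<open>k\<close>-th axis to
  \<open>\<nu>\<close> reduces it to a matrix that differs from the identity in one column.\<close>

lemma det_rank_one_update:
  fixes \<nu> u :: "real^'n"
  assumes \<nu>: "norm \<nu> = 1"
  shows "det (matrix (\<lambda>y. y + (\<nu> \<bullet> y) *\<^sub>R u)) = 1 + \<nu> \<bullet> u"
proof -
  fix k :: 'n
  obtain Q where Q: "orthogonal_transformation Q" "Q (axis k (1::real)) = \<nu>"
    by (rule orthogonal_transformation_exists_1[OF norm_axis_1[of k] \<nu>])
  define Q' where "Q' = inv Q"
  have Q': "orthogonal_transformation Q'" "\<And>x. Q' (Q x) = x" "\<And>x. Q (Q' x) = x"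
    using Q(1) orthogonal_transformation_bij[OF Q(1)]
    by (auto simp: Q'_def orthogonal_transformation_inv bij_is_inj bij_is_surj surj_f_inv_f)
  have Q_inner: "Q x \<bullet> Q y = x \<bullet> y" for x y
    using Q(1) by (simp add: orthogonal_transformation_def)
  have axis_inner: "axis k 1 \<bullet> Q' y = \<nu> \<bullet> y" for y
    using Q_inner[of "axis k 1" "Q' y"] by (simp only: Q(2) Q'(3))
  have lin: "linear Q" "linear Q'"
    using Q Q' orthogonal_transformation_linear by auto
  define T where "T = (\<lambda>y. y + (\<nu> \<bullet> y) *\<^sub>R u)"
  define S where "S = (\<lambda>y. y + (axis k 1 \<bullet> y) *\<^sub>R Q' u)"
  have linS: "linear S"
    unfolding S_def by (intro linearI) (auto simp: algebra_simps)
  have "Q (S (Q' y)) = T y" for y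
    unfolding S_def T_def by (simp add: linear_add[OF lin(1)] linear_scale[OF lin(1)] Q' axis_inner)
  then have TQ: "T = Q \<circ> (S \<circ> Q')"
    by (auto simp: fun_eq_iff)
  have "matrix T = matrix Q ** (matrix S ** matrix Q')"
    unfolding TQ by (simp add: matrix_compose lin linS linear_compose)
  then have "det (matrix T) = det (matrix S) * (det (matrix Q) * det (matrix Q'))"
    by (simp add: det_mul)
  also have "det (matrix Q) * det (matrix Q') = det (matrix (Q \<circ> Q'))"
    by (simp add: matrix_compose lin det_mul)
  also have "Q \<circ> Q' = id"
    by (auto simp: Q')
  \<comment> \<open>Column \<open>k\<close> of the identity is replaced by
    \<open>axis k 1 + Q' u\<close>. Written as \<open>mat 1\<close> applied to this vector it has
    the shape of Cramer's lemma, which reads off entry \<open>k\<close>.\<close>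
  also have "matrix S = (\<chi> i j. if j = k then (mat 1 *v (axis k 1 + Q' u))$i else (mat 1 :: real^'n^'n)$i$j)"
    unfolding matrix_vector_mul_lid
    by (simp add: vec_eq_iff matrix_def S_def mat_def inner_axis_axis) (simp add: axis_def)
  also have "det \<dots> = 1 + Q' u $ k"
    by (subst cramer_lemma) simp
  also have "Q' u $ k = axis k 1 \<bullet> Q' u"
    by (simp add: inner_axis inner_commute)
  also have "\<dots> = \<nu> \<bullet> u"
    by (rule axis_inner)
  finally show ?thesis
    by (simp only: T_def matrix_id_mat_1 det_I mult_1_right)
qed

lemma integral_lborel_rank_one_update_wellorder:
  fixes \<nu> u :: "real^'m::{finite,wellorder}" and g :: "real^'m::_ \<Rightarrow> real"
  assumes \<nu>: "norm \<nu> = 1" and nz: "1 + \<nu> \<bullet> u \<noteq> 0" and [measurable]: "g \<in> borel_measurable borel"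
  shows "(\<integral>x. g x \<partial>lborel) = \<bar>1 + \<nu> \<bullet> u\<bar> * (\<integral>y. g (y + (\<nu> \<bullet> y) *\<^sub>R u) \<partial>lborel)"
proof -
  define T where "T = (\<lambda>y. y + (\<nu> \<bullet> y) *\<^sub>R u)"
  have lin: "linear T"
    unfolding T_def by (intro linearI) (auto simp: algebra_simps)
  have det: "det (matrix T) = 1 + \<nu> \<bullet> u"
    unfolding T_def by (rule det_rank_one_update[OF \<nu>])
  have T[measurable]: "T \<in> borel_measurable borel"
    using lin by (intro borel_measurable_continuous_onI linear_continuous_on linear_conv_bounded_linear[THEN iffD1])
  obtain T' where T': "linear T'" "\<And>x. T' (T x) = x" "\<And>x. T (T' x) = x"
  proof -
    have "inj T"
      using det nz det_nz_iff_inj lin by metis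
    then obtain g where "linear g" "g \<circ> T = id"
      using linear_injective_left_inverse lin by blast
    moreover then have "T \<circ> g = id"
      using linear_inverse_left lin by blast
    ultimately show ?thesis
      using that by (metis comp_apply id_apply)
  qed
  \<comment> \<open>A comparison on boxes suffices: the preimage of a box under \<open>T\<close> is
    bounded and open, so it has finite measure, which \<open>T\<close> multiplies by the absolute
    value of its determinant.\<close>
  have "lborel = density (distr lborel borel T) (\<lambda>_. ennreal \<bar>1 + \<nu> \<bullet> u\<bar>)"
  proof (rule lborel_eqI)
    fix l v :: "real^'m::_"
    assume le: "\<And>b. b \<in> Basis \<Longrightarrow> l \<bullet> b \<le> v \<bullet> b"
    let ?A = "T -` box l v"
    have A_eq: "?A = T' ` box l v"
      using T' by (auto simp: image_iff) (metis T'(3))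
    have bd: "bounded ?A"
      unfolding A_eq using T' by (intro bounded_linear_image) (auto simp: linear_conv_bounded_linear)
    have op: "open ?A"
      using lin by (intro open_vimage linear_continuous_on linear_conv_bounded_linear[THEN iffD1]) auto
    have lm: "?A \<in> lmeasurable"
      using bd op by (simp add: lmeasurable_open)
    have "T ` ?A = box l v"
      using T' by (auto simp: image_iff) (metis T'(3))
    then have m: "measure lebesgue (box l v) = \<bar>1 + \<nu> \<bullet> u\<bar> * measure lebesgue ?A"
      using measure_linear_image[OF lin lm] det by simp
    have "emeasure (density (distr lborel borel T) (\<lambda>_. ennreal \<bar>1 + \<nu> \<bullet> u\<bar>)) (box l v)
       = ennreal \<bar>1 + \<nu> \<bullet> u\<bar> * emeasure lborel ?A"
      by (simp add: emeasure_density nn_integral_cmult emeasure_distr)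
    also have "\<dots> = ennreal \<bar>1 + \<nu> \<bullet> u\<bar> * ennreal (measure lborel ?A)"
      using emeasure_bounded_finite[OF bd] by (simp add: emeasure_eq_ennreal_measure)
    also have "\<dots> = ennreal (measure lebesgue (box l v))"
      using m op by (simp add: ennreal_mult measure_completion)
    also have "\<dots> = emeasure lborel (box l v)"
      using emeasure_bounded_finite[OF bounded_box, of l v] by (simp add: emeasure_eq_ennreal_measure)
    finally show "emeasure (density (distr lborel borel T) (\<lambda>_. ennreal \<bar>1 + \<nu> \<bullet> u\<bar>)) (box l v) =
        ennreal (\<Prod>b\<in>Basis. (v - l) \<bullet> b)"
      using le by simp
  qed simp
  then have "(\<integral>x. g x \<partial>lborel) = (\<integral>x. g x \<partial>density (distr lborel borel T) (\<lambda>_. ennreal \<bar>1 + \<nu> \<bullet> u\<bar>))"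
    by (rule arg_cong)
  also have "\<dots> = \<bar>1 + \<nu> \<bullet> u\<bar> * (\<integral>y. g (T y) \<partial>lborel)"
    by (subst integral_density) (simp_all add: integral_distr)
  finally show ?thesis
    by (simp add: T_def)
qed

lemma integral_lborel_rank_one_update:
  fixes \<nu> u :: "real^'n" and g :: "real^'n \<Rightarrow> real"
  assumes \<nu>: "norm \<nu> = 1" and nz: "1 + \<nu> \<bullet> u \<noteq> 0" and [measurable]: "g \<in> borel_measurable borel"
  shows "(\<integral>x. g x \<partial>lborel) = \<bar>1 + \<nu> \<bullet> u\<bar> * (\<integral>y. g (y + (\<nu> \<bullet> y - c) *\<^sub>R u) \<partial>lborel)"
proof -
  define R :: "real^'n \<Rightarrow> real^'n windex" where "R = (\<lambda>x. \<chi> i. x $ of_windex i)"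
  define R' :: "real^'n windex \<Rightarrow> real^'n" where "R' = (\<lambda>x. \<chi> i. x $ to_windex i)"
  define T where "T = (\<lambda>y. y + (\<nu> \<bullet> y) *\<^sub>R u)"
  have [measurable]: "R \<in> borel_measurable borel" "R' \<in> borel_measurable borel"
      "T \<in> borel_measurable borel"
    unfolding R_def R'_def T_def
    by (intro borel_measurable_continuous_onI continuous_intros)+
  have bij': "bij (to_windex :: 'n \<Rightarrow> 'n windex)"
    by (rule o_bij[of of_windex]) (auto simp: of_windex_inverse to_windex_inverse)
  have R'R: "R' (R x) = x" for x
    by (simp add: R_def R'_def vec_eq_iff to_windex_inverse)
  have R_inner: "R x \<bullet> R y = x \<bullet> y" for x y
    unfolding R_def inner_vec_def
    using sum.reindex_bij_betw[OF bij_of_windex, of "\<lambda>i. x $ i \<bullet> y $ i"] by simp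
  have R_lin: "R (x + r *\<^sub>R y) = R x + r *\<^sub>R R y" for x y r
    by (simp add: R_def vec_eq_iff)
  have norm_R: "norm (R \<nu>) = 1"
    using \<nu> R_inner by (simp add: norm_eq_sqrt_inner)
  have nz': "1 + R \<nu> \<bullet> R u \<noteq> 0"
    using nz R_inner by simp
  \<comment> \<open>The affine map is \<open>T\<close> after a translation along \<open>u\<close>.
    Translating by \<open>k u\<close> adds \<open>k (1 + \<nu> \<bullet> u) u\<close> to the result,
    and this has to equal \<open>- c u\<close>.\<close>
  have shift: "T (- (c / (1 + \<nu> \<bullet> u)) *\<^sub>R u + y) = y + (\<nu> \<bullet> y - c) *\<^sub>R u" for y
  proof -
    define k where "k = - (c / (1 + \<nu> \<bullet> u))"
    have "k * (1 + \<nu> \<bullet> u) = - c"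
      using nz by (simp add: k_def)
    then have "k + \<nu> \<bullet> (k *\<^sub>R u + y) = \<nu> \<bullet> y - c"
      by (simp add: inner_add_right algebra_simps)
    moreover have "T (k *\<^sub>R u + y) = y + (k + \<nu> \<bullet> (k *\<^sub>R u + y)) *\<^sub>R u"
      unfolding T_def scaleR_add_left by (simp only: ac_simps)
    ultimately show ?thesis
      by (simp only: k_def)
  qed
  have "(\<integral>x. g x \<partial>lborel) = (\<integral>y. g (R' y) \<partial>lborel)"
    unfolding R'_def by (rule integral_lborel_reindex[OF bij']) simp
  also have "\<dots> = \<bar>1 + R \<nu> \<bullet> R u\<bar> * (\<integral>y. g (R' (y + (R \<nu> \<bullet> y) *\<^sub>R R u)) \<partial>lborel)"
    by (rule integral_lborel_rank_one_update_wellorder[OF norm_R nz']) simp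
  also have "(\<integral>y. g (R' (y + (R \<nu> \<bullet> y) *\<^sub>R R u)) \<partial>lborel) =
      (\<integral>x. g (R' (R x + (R \<nu> \<bullet> R x) *\<^sub>R R u)) \<partial>lborel)"
    unfolding R_def by (rule integral_lborel_reindex[OF bij_of_windex]) measurable
  also have "\<dots> = (\<integral>x. g (T x) \<partial>lborel)"
    by (simp add: R_inner R'R T_def flip: R_lin)
  also have "\<dots> = (\<integral>x. g (T x) \<partial>distr lborel borel ((+) (- (c / (1 + \<nu> \<bullet> u)) *\<^sub>R u)))"
    by (simp only: lborel_distr_plus)
  also have "\<dots> = (\<integral>x. g (T (- (c / (1 + \<nu> \<bullet> u)) *\<^sub>R u + x)) \<partial>lborel)"
    by (subst integral_distr) simp_all
  finally show ?thesis
    by (simp only: shift R_inner)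
qed

section \<open>Facets of polytopes\<close>

text \<open>Minkowski sum of \<open>S\<close> with the segment from 0 to \<open>t d\<close>. For a
  facet, its outward normal and \<open>t = 1\<close> it is the prism used by
  \<open>face_int\<close>; for other directions it is an oblique prism.\<close>

definition sweep :: "(real^'n) set \<Rightarrow> real^'n \<Rightarrow> real \<Rightarrow> (real^'n) set" where
  "sweep S d t = {x + \<tau> *\<^sub>R d | x \<tau>. x \<in> S \<and> 0 \<le> \<tau> \<and> \<tau> \<le> t}"

lemma compact_sweep:
  assumes "compact S"
  shows "compact (sweep S d t)"
proof -
  have "sweep S d t = (\<lambda>(x, \<tau>). x + \<tau> *\<^sub>R d) ` (S \<times> {0..t})"
    by (auto simp: sweep_def image_iff) force
  moreover have "compact \<dots>"
    using assms
    by (intro compact_continuous_image compact_Times) (auto intro!: continuous_intros simp: split_beta)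
  ultimately show ?thesis by simp
qed

lemma subset_sweep: "0 \<le> t \<Longrightarrow> S \<subseteq> sweep S d t"
  by (force simp: sweep_def)

lemma sweep_mono: "S \<subseteq> T \<Longrightarrow> sweep S d t \<subseteq> sweep T d t"
  by (auto simp: sweep_def)

text \<open>The part of \<open>\<mu>\<close> orthogonal to \<open>\<nu>\<close> is a direction of
  the first hyperplane, along which \<open>\<mu>\<close> is constant. It is thus orthogonal to
  \<open>\<mu>\<close>, hence to itself, and vanishes.\<close>

lemma unit_normal_of_hyperplane:
  fixes \<nu> \<mu> :: "'a::real_inner"
  assumes \<nu>: "norm \<nu> = 1" and \<mu>: "norm \<mu> = 1"
    and sub: "{x. \<nu> \<bullet> x = c} \<subseteq> {x. \<mu> \<bullet> x = b}"
  shows "\<mu> = \<nu> \<or> \<mu> = - \<nu>"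
proof -
  have \<nu>\<nu>: "\<nu> \<bullet> \<nu> = 1"
    using \<nu> by (simp add: norm_eq_1)
  define w where "w = \<mu> - (\<nu> \<bullet> \<mu>) *\<^sub>R \<nu>"
  have \<nu>w: "\<nu> \<bullet> w = 0"
    by (simp add: w_def inner_diff_right \<nu>\<nu>)
  have "c *\<^sub>R \<nu> \<in> {x. \<mu> \<bullet> x = b}" "c *\<^sub>R \<nu> + w \<in> {x. \<mu> \<bullet> x = b}"
    by (rule subsetD[OF sub]; simp add: inner_add_right \<nu>\<nu> \<nu>w)+
  then have "\<mu> \<bullet> w = 0"
    by (simp add: inner_add_right)
  then have "w \<bullet> w = 0"
    using \<nu>w by (simp add: w_def inner_diff_left inner_diff_right inner_commute)
  then have \<mu>_eq: "\<mu> = (\<nu> \<bullet> \<mu>) *\<^sub>R \<nu>"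
    by (simp add: w_def)
  then have "\<bar>\<nu> \<bullet> \<mu>\<bar> = 1"
    using \<nu> \<mu> by (metis norm_scaleR mult.right_neutral)
  then have "\<nu> \<bullet> \<mu> = 1 \<or> \<nu> \<bullet> \<mu> = -1"
    by linarith
  then show ?thesis
    using \<mu>_eq by (metis scaleR_minus1_left scaleR_one)
qed

lemma closest_point_hyperplane:
  fixes \<nu> :: "'a::euclidean_space"
  assumes \<nu>: "norm \<nu> = 1"
  shows "closest_point {x. \<nu> \<bullet> x = c} y = y - (\<nu> \<bullet> y - c) *\<^sub>R \<nu>"
proof -
  have \<nu>\<nu>: "\<nu> \<bullet> \<nu> = 1"
    using \<nu> by (simp add: norm_eq_1)
  have "dist y (y - (\<nu> \<bullet> y - c) *\<^sub>R \<nu>) \<le> dist y z" if "\<nu> \<bullet> z = c" for z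
  proof -
    have "dist y (y - (\<nu> \<bullet> y - c) *\<^sub>R \<nu>) = \<bar>\<nu> \<bullet> (y - z)\<bar>"
      using that by (simp add: dist_norm \<nu> inner_diff_right)
    also have "\<dots> \<le> norm \<nu> * norm (y - z)"
      by (rule Cauchy_Schwarz_ineq2)
    finally show ?thesis
      by (simp add: \<nu> dist_norm)
  qed
  then show ?thesis
    by (intro closest_point_unique[symmetric])
       (auto simp: convex_hyperplane closed_hyperplane inner_diff_right \<nu>\<nu>)
qed

locale solid_polytope =
  fixes K :: "(real^'n::finite) set"
  assumes polytope: "polytope K" and solid: "interior K \<noteq> {}"
begin

lemma polyhedron: "polyhedron K"
  using polytope by (rule polytope_imp_polyhedron)

lemma compact: "compact K"
  using polytope by (rule polytope_imp_compact)

lemma convex: "convex K"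
  using polytope by (rule polytope_imp_convex)

lemma aff_dim: "aff_dim K = int (CARD('n))"
  using solid by (metis aff_dim_nonempty_interior DIM_cart DIM_real mult.right_neutral)

lemma finite_facets: "finite {F. F facet_of K}"
  using polytope by (rule finite_polytope_facets)

lemma facet_subset: "F facet_of K \<Longrightarrow> F \<subseteq> K"
  by (rule facet_of_imp_subset)

lemma facet_nonempty: "F facet_of K \<Longrightarrow> F \<noteq> {}"
  by (simp add: facet_of_def)

lemma compact_facet: "F facet_of K \<Longrightarrow> compact F"
  using polytope by (meson facet_of_imp_face_of face_of_polytope_polytope polytope_imp_compact)

lemma affine_hull_facet:
  assumes F: "F facet_of K" and "\<nu> \<noteq> 0" and sub: "F \<subseteq> {x. \<nu> \<bullet> x = c}"
  shows "affine hull F = {x. \<nu> \<bullet> x = c}"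
proof (rule affine_dim_equal)
  show "affine hull F \<subseteq> {x. \<nu> \<bullet> x = c}"
    using sub by (simp add: affine_hyperplane hull_minimal)
  show "aff_dim (affine hull F) = aff_dim {x. \<nu> \<bullet> x = c}"
    using F \<open>\<nu> \<noteq> 0\<close> by (simp add: facet_of_def aff_dim)
  show "affine hull F \<noteq> {}"
    using F by (simp add: facet_nonempty)
qed (auto simp: affine_hyperplane)

text \<open>The definition is a definite description, so uniqueness is the point. A competitor is a
  unit normal of the same affine hull, hence \<open>\<nu>\<close> or \<open>- \<nu>\<close>; the
  wrong sign would confine \<open>K\<close> to a hyperplane and leave it without interior.\<close>

lemma outward_normal_eqI:
  assumes F: "F facet_of K" and \<nu>: "norm \<nu> = 1" "K \<subseteq> {x. \<nu> \<bullet> x \<le> c}" "F = K \<inter> {x. \<nu> \<bullet> x = c}"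
  shows "outward_normal K F = \<nu>"
  unfolding outward_normal_def
proof (rule the_equality)
  show "norm \<nu> = 1 \<and> (\<exists>c. K \<subseteq> {x. \<nu> \<bullet> x \<le> c} \<and> F = K \<inter> {x. \<nu> \<bullet> x = c})"
    using \<nu> by blast
next
  fix \<mu>
  assume "norm \<mu> = 1 \<and> (\<exists>c. K \<subseteq> {x. \<mu> \<bullet> x \<le> c} \<and> F = K \<inter> {x. \<mu> \<bullet> x = c})"
  then obtain b where \<mu>: "norm \<mu> = 1" "K \<subseteq> {x. \<mu> \<bullet> x \<le> b}" "F = K \<inter> {x. \<mu> \<bullet> x = b}"
    by blast
  have hull: "affine hull F = {x. \<nu> \<bullet> x = c}" "affine hull F = {x. \<mu> \<bullet> x = b}"
    using F \<nu> \<mu> by (intro affine_hull_facet; force)+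
  then have "\<mu> = \<nu> \<or> \<mu> = - \<nu>"
    using unit_normal_of_hyperplane[of \<nu> \<mu> c b] \<nu> \<mu> by simp
  moreover have False if "\<mu> = - \<nu>"
  proof -
    obtain x where "x \<in> F"
      using facet_nonempty[OF F] by blast
    then have "\<nu> \<bullet> x = c" "\<mu> \<bullet> x = b"
      using \<nu> \<mu> by auto
    then have "b = - c"
      using that by simp
    then have "K \<subseteq> {x. \<nu> \<bullet> x = c}"
      using \<nu>(2) \<mu>(2) that by force
    then have "interior K \<subseteq> interior {x. \<nu> \<bullet> x = c}"
      by (rule interior_mono)
    moreover have "\<nu> \<noteq> 0"
      using \<nu> by auto
    ultimately show False
      using solid by (simp add: interior_hyperplane)
  qed
  ultimately show "\<mu> = \<nu>" by blast
qed

text \<open>The chosen point is immaterial, since a facet lies in one hyperplane orthogonal to its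
  normal.\<close>

definition level :: "(real^'n) set \<Rightarrow> real" where
  "level F = outward_normal K F \<bullet> (SOME x. x \<in> F)"

lemma outward_normal_level_eqI:
  assumes F: "F facet_of K" and a: "a \<noteq> 0" "K \<subseteq> {x. a \<bullet> x \<le> b}" "F = K \<inter> {x. a \<bullet> x = b}"
  shows "outward_normal K F = a /\<^sub>R norm a" "level F = b / norm a"
proof -
  have "F = K \<inter> {x. (a /\<^sub>R norm a) \<bullet> x = b / norm a}" "K \<subseteq> {x. (a /\<^sub>R norm a) \<bullet> x \<le> b / norm a}"
    using a by (auto simp: field_simps)
  then show n: "outward_normal K F = a /\<^sub>R norm a"
    using a by (intro outward_normal_eqI[OF F]) auto
  have "(SOME x. x \<in> F) \<in> F"
    using facet_nonempty[OF F] by (simp add: some_in_eq)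
  then have "a \<bullet> (SOME x. x \<in> F) = b"
    using a(3) by blast
  then show "level F = b / norm a"
    unfolding level_def n by (simp add: divide_inverse mult.commute)
qed

lemma facet:
  assumes F: "F facet_of K"
  shows norm_outward_normal: "norm (outward_normal K F) = 1"
    and below_level: "\<And>x. x \<in> K \<Longrightarrow> outward_normal K F \<bullet> x \<le> level F"
    and facet_eq: "F = K \<inter> {x. outward_normal K F \<bullet> x = level F}"
proof -
  obtain a b where ab: "a \<noteq> 0" "K \<subseteq> {x. a \<bullet> x \<le> b}" "F = K \<inter> {x. a \<bullet> x = b}"
    using facet_of_polyhedron[OF polyhedron F] by blast
  note n = outward_normal_level_eqI[OF F ab]
  show "norm (outward_normal K F) = 1"
    unfolding n using ab by simp
  show "outward_normal K F \<bullet> x \<le> level F" if "x \<in> K" for x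
    unfolding n using ab that by (auto simp: field_simps)
  have "{x. (a /\<^sub>R norm a) \<bullet> x = b / norm a} = {x. a \<bullet> x = b}"
    using ab(1) by (auto simp: field_simps)
  then show "F = K \<inter> {x. outward_normal K F \<bullet> x = level F}"
    unfolding n using ab(3) by simp
qed

lemma on_level: "F facet_of K \<Longrightarrow> x \<in> F \<Longrightarrow> outward_normal K F \<bullet> x = level F"
  using facet_eq by blast

lemma facetI: "F facet_of K \<Longrightarrow> x \<in> K \<Longrightarrow> outward_normal K F \<bullet> x = level F \<Longrightarrow> x \<in> F"
  using facet_eq by blast

lemma outward_normal_inner_self:
  "F facet_of K \<Longrightarrow> outward_normal K F \<bullet> outward_normal K F = 1"
  using norm_outward_normal by (simp add: norm_eq_1)

text \<open>In a minimal representation of \<open>K\<close> by halfspaces every bounding hyperplane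
  meets \<open>K\<close> in a facet, and the normalized inequality is the one given by the normal
  and level of that facet.\<close>

lemma mem_iff_below_levels:
  "x \<in> K \<longleftrightarrow> (\<forall>F. F facet_of K \<longrightarrow> outward_normal K F \<bullet> x \<le> level F)"
proof
  assume *: "\<forall>F. F facet_of K \<longrightarrow> outward_normal K F \<bullet> x \<le> level F"
  obtain H where H: "finite H" "K = affine hull K \<inter> \<Inter>H"
      "\<forall>h\<in>H. \<exists>a b. a \<noteq> 0 \<and> h = {x. a \<bullet> x \<le> b}"
      "\<And>H'. H' \<subset> H \<Longrightarrow> K \<subset> affine hull K \<inter> \<Inter>H'"
    using polyhedron[unfolded polyhedron_Int_affine_minimal] by auto
  from H(3) obtain a b where ab: "\<And>h. h \<in> H \<Longrightarrow> a h \<noteq> 0 \<and> h = {x. a h \<bullet> x \<le> b h}"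
    by metis
  have "x \<in> h" if h: "h \<in> H" for h
  proof -
    let ?F = "K \<inter> {x. a h \<bullet> x = b h}"
    have F: "?F facet_of K"
      using facet_of_polyhedron_explicit[OF H(1,2) ab H(4)] h by blast
    have "K \<subseteq> h"
      using H(2) h by blast
    then have "K \<subseteq> {x. a h \<bullet> x \<le> b h}"
      using ab[OF h] by simp
    then have "outward_normal K ?F = a h /\<^sub>R norm (a h)" "level ?F = b h / norm (a h)"
      using outward_normal_level_eqI[OF F] ab[OF h] by auto
    then have "a h \<bullet> x \<le> b h"
      using *[rule_format, OF F] ab[OF h] by (simp add: field_simps)
    then show ?thesis
      using ab[OF h] by blast
  qed
  moreover have "affine hull K = UNIV"
    by (rule affine_hull_nonempty_interior[OF solid])
  ultimately show "x \<in> K"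
    using H(2) by blast
qed (use below_level in blast)

lemma affine_hull_facet_eq:
  "F facet_of K \<Longrightarrow> affine hull F = {x. outward_normal K F \<bullet> x = level F}"
  using norm_outward_normal[of F] on_level[of F] by (intro affine_hull_facet) auto

lemma closest_point_facet:
  "F facet_of K \<Longrightarrow> closest_point (affine hull F) y =
     y - (outward_normal K F \<bullet> y - level F) *\<^sub>R outward_normal K F"
  by (simp add: affine_hull_facet_eq closest_point_hyperplane norm_outward_normal)

text \<open>A relative interior point of \<open>F\<close> lies on no other facet. The other
  inequalities are therefore strict and survive a small displacement, and a displacement inwards
  makes that of \<open>F\<close> strict too.\<close>

lemma eventually_interior_below_facet:
  assumes F: "F facet_of K" and x: "x \<in> rel_interior F"
  shows "\<forall>\<^sub>F \<epsilon> in at_right 0. x - \<epsilon> *\<^sub>R outward_normal K F \<in> interior K"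
proof -
  have xF: "x \<in> F"
    using x rel_interior_subset by blast
  then have xK: "x \<in> K"
    using facet_subset[OF F] by blast
  \<comment> \<open>If \<open>x\<close> were on \<open>G\<close>, the face
    \<open>G \<inter> F\<close> would meet the relative interior of \<open>F\<close> and so be all
    of \<open>F\<close>. Then \<open>F\<close> would be a proper face of \<open>G\<close> and have
    lower dimension, although both are facets.\<close>
  have strict: "outward_normal K G \<bullet> x < level G" if G: "G facet_of K" "G \<noteq> F" for G
  proof (rule ccontr)
    assume "\<not> ?thesis"
    then have "x \<in> G"
      using below_level[OF G(1) xK] by (intro facetI[OF G(1) xK]) auto
    have face: "G \<inter> F face_of K"
      using F G by (intro face_of_Int facet_of_imp_face_of)
    then have "G \<inter> F face_of F"
      by (rule face_of_subset) (use facet_subset[OF F] in auto)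
    then have "G \<inter> F = F"
      using face_of_disjoint_rel_interior[of "G \<inter> F" F] x xF \<open>x \<in> G\<close> by blast
    then have "F face_of G"
      using face facet_subset[OF G(1)] by (metis face_of_subset inf_le1)
    moreover have "convex G"
      using G(1) face_of_imp_convex facet_of_imp_face_of by blast
    ultimately have "aff_dim F < aff_dim G"
      using face_of_aff_dim_lt G(2) by blast
    then show False
      using F G by (simp add: facet_of_def)
  qed
  let ?y = "\<lambda>\<epsilon>. x - \<epsilon> *\<^sub>R outward_normal K F"
  define U where "U = (\<Inter>G\<in>{G. G facet_of K}. {y. outward_normal K G \<bullet> y < level G})"
  have "open U"
    unfolding U_def using finite_facets by (intro open_INT ballI open_halfspace_lt)
  moreover have "U \<subseteq> K"
    by (auto simp: U_def mem_iff_below_levels less_imp_le)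
  ultimately have UK: "U \<subseteq> interior K"
    by (rule interior_maximal[rotated])
  have "\<forall>\<^sub>F \<epsilon> in at_right 0. outward_normal K G \<bullet> ?y \<epsilon> < level G" if G: "G facet_of K" for G
  proof (cases "G = F")
    case True
    have "\<forall>\<^sub>F \<epsilon> in at_right (0::real). 0 < \<epsilon>"
      by (rule eventually_at_right_less)
    then show ?thesis
      by eventually_elim
         (simp add: True inner_diff_right on_level[OF F xF] outward_normal_inner_self[OF F])
  next
    case False
    have "((\<lambda>\<epsilon>. outward_normal K G \<bullet> ?y \<epsilon>) \<longlongrightarrow> outward_normal K G \<bullet> ?y 0) (at_right 0)"
      by (intro tendsto_intros)
    then show ?thesis
      by (rule order_tendstoD(2)) (simp add: strict[OF G False])
  qed
  then have "\<forall>\<^sub>F \<epsilon> in at_right 0. \<forall>G\<in>{G. G facet_of K}. outward_normal K G \<bullet> ?y \<epsilon> < level G"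
    using finite_facets by (intro eventually_ball_finite) auto
  then show ?thesis
    by eventually_elim (use UK in \<open>auto simp: U_def\<close>)
qed

text \<open>A trajectory from \<open>K\<close> with velocity \<open>d\<close> leaves only through a
  facet facing \<open>d\<close>. It exits where the first of their inequalities becomes tight; the
  remaining inequalities still hold there.\<close>

lemma mem_sweep_iff:
  assumes t: "0 \<le> t"
  shows "y \<in> sweep K d t \<longleftrightarrow>
    y \<in> K \<or> (\<exists>F. F facet_of K \<and> 0 < outward_normal K F \<bullet> d \<and> y \<in> sweep F d t)"
    (is "?lhs \<longleftrightarrow> ?rhs")
proof
  assume ?rhs
  then show ?lhs
    using subset_sweep[OF t, of K d] sweep_mono[OF facet_subset] by blast
next
  assume ?lhs
  then obtain x \<tau> where x: "x \<in> K" "0 \<le> \<tau>" "\<tau> \<le> t" "y = x + \<tau> *\<^sub>R d"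
    by (auto simp: sweep_def)
  show ?rhs
  proof (cases "y \<in> K")
    case False
    define H where "H = {F. F facet_of K \<and> 0 < outward_normal K F \<bullet> d}"
    \<comment> \<open>The time at which the trajectory from \<open>x\<close> reaches the plane of
      \<open>F\<close>; the minimum over \<open>H\<close> is the exit time.\<close>
    define \<sigma> where "\<sigma> F = (level F - outward_normal K F \<bullet> x) / (outward_normal K F \<bullet> d)" for F
    have finH: "finite H"
      by (rule finite_subset[OF _ finite_facets]) (auto simp: H_def)
    \<comment> \<open>A violated inequality shows that \<open>H\<close> is nonempty and that the
      exit happens before time \<open>\<tau>\<close>, so the remaining time lies in
      \<open>[0, t]\<close>.\<close>
    obtain G where G: "G facet_of K" "level G < outward_normal K G \<bullet> y"
      using False mem_iff_below_levels by force
    then have GH: "G \<in> H" and \<sigma>G: "\<sigma> G < \<tau>"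
    proof -
      have *: "level G - outward_normal K G \<bullet> x < \<tau> * (outward_normal K G \<bullet> d)"
        using G by (simp add: x inner_add_right)
      have "0 < \<tau> * (outward_normal K G \<bullet> d)"
        using * below_level[OF G(1) x(1)] by linarith
      then have "0 < outward_normal K G \<bullet> d"
        using x(2) by (simp add: zero_less_mult_iff)
      then show "G \<in> H" "\<sigma> G < \<tau>"
        using G * by (auto simp: H_def \<sigma>_def field_simps)
    qed
    have "Min (\<sigma> ` H) \<in> \<sigma> ` H"
      using finH GH by (intro Min_in) auto
    then obtain F where F: "F \<in> H" and "\<sigma> F = Min (\<sigma> ` H)"
      by auto
    then have minF: "\<sigma> F \<le> \<sigma> E" if "E \<in> H" for E
      using finH that by simp
    have Ff: "F facet_of K" and Fd: "0 < outward_normal K F \<bullet> d"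
      using F by (auto simp: H_def)
    have \<sigma>0: "0 \<le> \<sigma> F"
      using below_level[OF Ff x(1)] Fd by (simp add: \<sigma>_def)
    define z where "z = x + \<sigma> F *\<^sub>R d"
    have "outward_normal K E \<bullet> z \<le> level E" if E: "E facet_of K" for E
    proof (cases "E \<in> H")
      case True
      then show ?thesis
        using minF[OF True] by (simp add: H_def z_def inner_add_right \<sigma>_def[of E] field_simps)
    next
      case False
      then have "\<sigma> F * (outward_normal K E \<bullet> d) \<le> 0"
        using \<sigma>0 E by (simp add: H_def mult_nonneg_nonpos)
      then show ?thesis
        using below_level[OF E x(1)] by (simp add: z_def inner_add_right)
    qed
    then have "z \<in> K"
      by (simp add: mem_iff_below_levels)
    moreover have "outward_normal K F \<bullet> z = level F"
      using Fd by (simp add: z_def inner_add_right \<sigma>_def)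
    ultimately have "z \<in> F"
      by (rule facetI[OF Ff])
    moreover have "y = z + (\<tau> - \<sigma> F) *\<^sub>R d"
      by (simp add: z_def x algebra_simps)
    moreover have "0 \<le> \<tau> - \<sigma> F" "\<tau> - \<sigma> F \<le> t"
      using minF[OF GH] \<sigma>G \<sigma>0 x by auto
    ultimately have "y \<in> sweep F d t"
      unfolding sweep_def by blast
    then show ?thesis
      using Ff Fd by blast
  qed simp
qed

end

section \<open>Two polytopes sharing a facet\<close>

lemma common_facet_normal:
  assumes K: "solid_polytope K" "F facet_of K" and K': "solid_polytope K'" "F facet_of K'"
  shows "outward_normal K' F = outward_normal K F \<or> outward_normal K' F = - outward_normal K F"
proof -
  interpret K: solid_polytope K by fact
  interpret K': solid_polytope K' by fact
  show ?thesis
    using K.affine_hull_facet_eq[OF K(2)] K'.affine_hull_facet_eq[OF K'(2)]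
      K.norm_outward_normal[OF K(2)] K'.norm_outward_normal[OF K'(2)]
    by (intro unit_normal_of_hyperplane[where c = "K.level F" and b = "K'.level F"]) auto
qed

text \<open>From a relative interior point of the facet, a short step against the common normal
  enters both polytopes. This later forces neighbouring cells to have opposite normals.\<close>

lemma interiors_meet_if_same_facet_normal:
  assumes K: "solid_polytope K" "F facet_of K" and K': "solid_polytope K'" "F facet_of K'"
    and eq: "outward_normal K' F = outward_normal K F"
  shows "interior K \<inter> interior K' \<noteq> {}"
proof -
  interpret K: solid_polytope K by fact
  interpret K': solid_polytope K' by fact
  have "convex F" "F \<noteq> {}"
    using K(2) facet_of_imp_face_of face_of_imp_convex K.facet_nonempty by blast+
  then obtain x where x: "x \<in> rel_interior F"
    using rel_interior_eq_empty by blast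
  have "\<forall>\<^sub>F \<epsilon> in at_right 0. x - \<epsilon> *\<^sub>R outward_normal K F \<in> interior K \<inter> interior K'"
    using K.eventually_interior_below_facet[OF K(2) x] K'.eventually_interior_below_facet[OF K'(2) x]
    unfolding eq by eventually_elim blast
  then show ?thesis
    using eventually_happens'[OF trivial_limit_at_right_real] by blast
qed

section \<open>The divergence theorem on polytopes\<close>

lemma null_sets_lborel_if_negligible:
  "S \<in> sets borel \<Longrightarrow> negligible S \<Longrightarrow> S \<in> null_sets lborel"
  by (simp add: negligible_iff_null_sets null_sets_completion_iff)

lemma set_integrable_lborel_compact:
  fixes f :: "'a::euclidean_space \<Rightarrow> real"
  assumes "compact S" "continuous_on S f"
  shows "set_integrable lborel S f"
  unfolding set_integrable_def using assms by (rule borel_integrable_compact)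

lemma set_lebesgue_integral_translate:
  fixes f :: "'a::euclidean_space \<Rightarrow> real"
  assumes S: "S \<in> sets borel" and [measurable]: "f \<in> borel_measurable borel"
    and T: "\<And>x. x \<in> T \<longleftrightarrow> x + a \<in> S"
  shows "(LINT x:T|lborel. f (x + a)) = (LINT x:S|lborel. f x)"
proof -
  have "(LINT x:S|lborel. f x) = (\<integral>x. indicator S x *\<^sub>R f x \<partial>distr lborel borel ((+) a))"
    unfolding set_lebesgue_integral_def by (simp only: lborel_distr_plus)
  also have "\<dots> = (\<integral>x. indicator S (a + x) *\<^sub>R f (a + x) \<partial>lborel)"
    using S by (subst integral_distr) auto
  also have "\<dots> = (LINT x:T|lborel. f (x + a))"
    unfolding set_lebesgue_integral_def using T
    by (intro Bochner_Integration.integral_cong) (auto simp: indicator_def add.commute)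
  finally show ?thesis by simp
qed

text \<open>Dominated convergence with a constant bound: all parameters lie in
  \<open>[0, 1]\<close>, and \<open>h\<close> is bounded on the compact product of \<open>S\<close>
  with this interval.\<close>

lemma tendsto_set_lebesgue_integral_compact:
  fixes h :: "'a::euclidean_space \<Rightarrow> real \<Rightarrow> real"
  assumes S: "compact S" and h: "continuous_on UNIV (\<lambda>(x, t). h x t)"
  shows "(\<lambda>n. LINT x:S|lborel. h x (inverse (real (Suc n)))) \<longlonglongrightarrow> (LINT x:S|lborel. h x 0)"
proof -
  have cont: "continuous_on A (\<lambda>x. h x t)" for A t
    using continuous_on_compose2[OF h, of A "\<lambda>x. (x, t)"] by (simp add: continuous_intros)
  have cont_t: "continuous_on A (\<lambda>t. h x t)" for A x
    using continuous_on_compose2[OF h, of A "\<lambda>t. (x, t)"] by (simp add: continuous_intros)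
  have "compact ((\<lambda>(x, t). h x t) ` (S \<times> {0..1}))"
    using S by (intro compact_continuous_image compact_Times continuous_on_subset[OF h]) auto
  then obtain B where B: "\<And>x t. x \<in> S \<Longrightarrow> 0 \<le> t \<Longrightarrow> t \<le> 1 \<Longrightarrow> \<bar>h x t\<bar> \<le> B"
    by (force dest!: compact_imp_bounded simp: bounded_real)
  have S_sets: "S \<in> sets borel"
    using S by (rule borel_compact)
  show ?thesis
    unfolding set_lebesgue_integral_def
  proof (rule integral_dominated_convergence[where w = "\<lambda>x. indicator S x *\<^sub>R B"])
    show "integrable lborel (\<lambda>x. indicator S x *\<^sub>R B)"
      using S by (intro borel_integrable_compact) auto
    show "(\<lambda>x. indicator S x *\<^sub>R h x 0) \<in> borel_measurable lborel"
      using borel_integrable_compact[OF S cont] by (rule borel_measurable_integrable)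
    show "(\<lambda>x. indicator S x *\<^sub>R h x (inverse (real (Suc n)))) \<in> borel_measurable lborel" for n
      using borel_integrable_compact[OF S cont] by (rule borel_measurable_integrable)
    have "(\<lambda>n. h x (inverse (real (Suc n)))) \<longlonglongrightarrow> h x 0" for x
      using continuous_on_tendsto_compose[OF cont_t[of UNIV x] LIMSEQ_inverse_real_of_nat] by simp
    then show "AE x in lborel. (\<lambda>n. indicator S x *\<^sub>R h x (inverse (real (Suc n))))
        \<longlonglongrightarrow> indicator S x *\<^sub>R h x 0"
      by (intro AE_I2 tendsto_intros)
    have "inverse (real (Suc n)) \<le> 1" for n
      by (simp add: field_simps)
    then show "AE x in lborel. norm (indicator S x *\<^sub>R h x (inverse (real (Suc n)))) \<le> indicator S x *\<^sub>R B" for n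
      by (intro AE_I2) (auto simp: indicator_def B)
  qed
qed

text \<open>The quotient exists as a continuous function of point and step together, including step
  0, by induction on the construction of the polynomial. It replaces remainder estimates when the
  limit is taken under an integral.\<close>

lemma real_polynomial_function_difference_quotient:
  fixes g :: "'a::real_normed_vector \<Rightarrow> real"
  assumes "real_polynomial_function g"
  obtains q where "continuous_on UNIV (\<lambda>(x, t). q x t)"
    "\<And>x t. g (x + t *\<^sub>R d) - g x = t * q x t"
proof -
  have "\<exists>q. continuous_on UNIV (\<lambda>(x, t). q x t) \<and> (\<forall>x t. g (x + t *\<^sub>R d) - g x = t * q x t)"
    using assms
  proof induction
    case (linear f)
    then have "linear f" by (rule bounded_linear.linear)
    then show ?case
      by (intro exI[of _ "\<lambda>x t. f d"]) (auto simp: linear_add linear_scale)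
  next
    case (const c)
    then show ?case
      by (intro exI[of _ "\<lambda>x t. 0"]) auto
  next
    case (add f1 f2)
    then obtain q1 q2 where
      "continuous_on UNIV (\<lambda>(x, t). q1 x t)" "\<And>x t. f1 (x + t *\<^sub>R d) - f1 x = t * q1 x t"
      "continuous_on UNIV (\<lambda>(x, t). q2 x t)" "\<And>x t. f2 (x + t *\<^sub>R d) - f2 x = t * q2 x t"
      by blast
    then show ?case
      by (intro exI[of _ "\<lambda>x t. q1 x t + q2 x t"])
         (auto simp: split_beta distrib_left algebra_simps intro!: continuous_intros)
  next
    case (mult f1 f2)
    then obtain q1 q2 where q:
      "continuous_on UNIV (\<lambda>(x, t). q1 x t)" "\<And>x t. f1 (x + t *\<^sub>R d) - f1 x = t * q1 x t"
      "continuous_on UNIV (\<lambda>(x, t). q2 x t)" "\<And>x t. f2 (x + t *\<^sub>R d) - f2 x = t * q2 x t"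
      by blast
    have cont: "continuous_on UNIV f1" "continuous_on UNIV f2"
      using mult continuous_on_polymonial_function real_polynomial_function_eq by blast+
    \<comment> \<open>Discrete Leibniz rule: the second factor is evaluated at the advanced point in
      the first term only.\<close>
    let ?q = "\<lambda>x t. q1 x t * f2 (x + t *\<^sub>R d) + f1 x * q2 x t"
    have "continuous_on UNIV (\<lambda>p. ?q (fst p) (snd p))"
      using q(1,3)
      by (auto simp: split_beta intro!: continuous_intros continuous_on_compose2[OF cont(1)]
          continuous_on_compose2[OF cont(2)])
    moreover have "f1 (x + t *\<^sub>R d) * f2 (x + t *\<^sub>R d) - f1 x * f2 x = t * ?q x t" for x t
    proof -
      have "f1 (x + t *\<^sub>R d) * f2 (x + t *\<^sub>R d) - f1 x * f2 x =
          (f1 (x + t *\<^sub>R d) - f1 x) * f2 (x + t *\<^sub>R d) + f1 x * (f2 (x + t *\<^sub>R d) - f2 x)"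
        by (simp add: algebra_simps)
      then show ?thesis
        by (simp only: q) (simp add: algebra_simps)
    qed
    ultimately show ?case
      by (intro exI[of _ ?q]) (simp add: split_beta)
  qed
  then show ?thesis
    using that by blast
qed

text \<open>Away from \<open>t = 0\<close> the function \<open>q\<close> is the difference quotient,
  so by continuity its value at 0 is the limit of the quotients.\<close>

lemma frechet_derivative_eq_difference_quotient:
  assumes g: "g differentiable (at x)"
    and q: "continuous_on UNIV q" "\<And>t. g (x + t *\<^sub>R d) - g x = t * q t"
  shows "frechet_derivative g (at x) d = (q 0 :: real)"
proof -
  have *: "(g has_derivative frechet_derivative g (at x)) (at (x + 0 *\<^sub>R d))"
    using g by (simp add: frechet_derivative_works)
  have "((\<lambda>t. g (x + t *\<^sub>R d)) has_derivative (\<lambda>t. frechet_derivative g (at x) (t *\<^sub>R d))) (at 0)"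
    by (rule has_derivative_compose[where f = "\<lambda>t. x + t *\<^sub>R d" and f' = "\<lambda>t. t *\<^sub>R d", OF _ *])
       (auto intro!: derivative_eq_intros)
  moreover have "(\<lambda>t. frechet_derivative g (at x) (t *\<^sub>R d)) = (*) (frechet_derivative g (at x) d)"
    using linear_frechet_derivative[OF g] by (auto simp: linear_scale mult.commute)
  ultimately have "((\<lambda>t. g (x + t *\<^sub>R d)) has_field_derivative frechet_derivative g (at x) d) (at 0)"
    by (simp add: has_field_derivative_def)
  then have "((\<lambda>h. (g (x + h *\<^sub>R d) - g x) / h) \<longlongrightarrow> frechet_derivative g (at x) d) (at 0)"
    by (simp add: DERIV_def)
  moreover have "((\<lambda>h. (g (x + h *\<^sub>R d) - g x) / h) \<longlongrightarrow> q 0) (at 0)"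
  proof (rule Lim_transform_eventually)
    show "(q \<longlongrightarrow> q 0) (at 0)"
      using q(1) by (simp add: continuous_on_eq_continuous_at isCont_def)
    show "\<forall>\<^sub>F h in at 0. q h = (g (x + h *\<^sub>R d) - g x) / h"
      unfolding eventually_at_filter by (simp add: q)
  qed
  ultimately show ?thesis
    by (rule tendsto_unique[rotated]) simp
qed

section \<open>Decomposition of a swept polytope\<close>

context solid_polytope
begin

lemma facet_null:
  assumes "F facet_of K"
  shows "F \<in> null_sets lborel"
proof (rule null_sets_lborel_if_negligible)
  show "F \<in> sets borel"
    using compact_facet[OF assms] by (rule borel_compact)
  show "negligible F"
    by (rule negligible_subset[of "{x. outward_normal K F \<bullet> x = level F}"])
       (use norm_outward_normal[OF assms] on_level[OF assms] in \<open>auto intro!: negligible_hyperplane\<close>)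
qed

text \<open>Two distinct facets meet in a face of codimension at least two. Sweeping adds at most
  one dimension, so the result stays in a hyperplane. Overlaps of two prisms lie in such
  sets.\<close>

lemma sweep_ridge_null:
  assumes F: "F facet_of K" and G: "G facet_of K" "G \<noteq> F"
  shows "sweep (F \<inter> G) d t \<in> null_sets lborel"
proof (rule null_sets_lborel_if_negligible)
  show "sweep (F \<inter> G) d t \<in> sets borel"
    using compact_facet[OF F] compact_facet[OF G(1)] by (intro borel_compact compact_sweep compact_Int)
  show "negligible (sweep (F \<inter> G) d t)"
  proof (cases "F \<inter> G = {}")
    case True
    then show ?thesis by (simp add: sweep_def)
  next
    case False
    then obtain a where a: "a \<in> F \<inter> G" by blast
    have face: "F \<inter> G face_of K"
      using F G by (intro face_of_Int facet_of_imp_face_of)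
    have cvx: "convex F" "convex G"
      using F G face_of_imp_convex facet_of_imp_face_of by blast+
    have "F \<inter> G face_of F" "F \<inter> G face_of G"
      by (rule face_of_subset[OF face]; use facet_subset[OF F] facet_subset[OF G(1)] in auto)+
    moreover have "F \<inter> G \<noteq> F \<or> F \<inter> G \<noteq> G"
      using G(2) by blast
    ultimately have "aff_dim (F \<inter> G) < aff_dim F \<or> aff_dim (F \<inter> G) < aff_dim G"
      using face_of_aff_dim_lt cvx by blast
    then have "aff_dim (F \<inter> G) + 1 < int CARD('n)"
      using F G by (auto simp: facet_of_def aff_dim)
    \<comment> \<open>Adjoining the single point \<open>a + d\<close>, with \<open>a\<close> in the
      ridge, puts the direction \<open>d\<close> into the affine hull and raises the dimension by at
      most one.\<close>
    then have "aff_dim (insert (a + d) (F \<inter> G)) < DIM(real^'n)"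
      by (simp add: aff_dim_insert)
    then have "aff_dim (affine hull (insert (a + d) (F \<inter> G))) < DIM(real^'n)"
      by (simp only: aff_dim_affine_hull)
    then obtain u b where u: "u \<noteq> 0" "affine hull (insert (a + d) (F \<inter> G)) \<subseteq> {x. u \<bullet> x = b}"
      by (rule aff_lowdim_subset_hyperplane)
    have "sweep (F \<inter> G) d t \<subseteq> affine hull (insert (a + d) (F \<inter> G))"
    proof
      fix y assume "y \<in> sweep (F \<inter> G) d t"
      then obtain x \<tau> where x: "x \<in> F \<inter> G" "y = x + \<tau> *\<^sub>R d"
        by (auto simp: sweep_def)
      have "1 *\<^sub>R x + \<tau> *\<^sub>R (a + d) + (- \<tau>) *\<^sub>R a \<in> affine hull (insert (a + d) (F \<inter> G))"
        using x a by (intro mem_affine_3 affine_affine_hull hull_inc) auto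
      then show "y \<in> affine hull (insert (a + d) (F \<inter> G))"
        by (simp add: x algebra_simps)
    qed
    then have "sweep (F \<inter> G) d t \<subseteq> {x. u \<bullet> x = b}"
      using u(2) by (rule order_trans)
    then show ?thesis
      by (rule negligible_subset[rotated]) (simp add: negligible_hyperplane u)
  qed
qed

lemma integral_sweep:
  fixes g :: "real^'n \<Rightarrow> real"
  assumes t: "0 \<le> t" and g: "continuous_on UNIV g"
  shows "(LINT x:sweep K d t|lborel. g x) = (LINT x:K|lborel. g x) +
    (\<Sum>F | F facet_of K \<and> 0 < outward_normal K F \<bullet> d. LINT x:sweep F d t|lborel. g x)"
proof -
  define H where "H = {F. F facet_of K \<and> 0 < outward_normal K F \<bullet> d}"
  have finH: "finite H"
    by (rule finite_subset[OF _ finite_facets]) (auto simp: H_def)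
  have HF: "F facet_of K" if "F \<in> H" for F
    using that by (simp add: H_def)
  have Hd: "0 < outward_normal K F \<bullet> d" if "F \<in> H" for F
    using that by (simp add: H_def)
  \<comment> \<open>The exceptional set: facets contain the common points of \<open>K\<close> and a
    prism, swept ridges those of two prisms. Off \<open>Z\<close> the indicator functions add up
    exactly.\<close>
  define Z where "Z = \<Union>H \<union> (\<Union>(F, G)\<in>{(F, G). F \<in> H \<and> G \<in> H \<and> G \<noteq> F}. sweep (F \<inter> G) d t)"
  have "finite {(F, G). F \<in> H \<and> G \<in> H \<and> G \<noteq> F}"
    by (rule finite_subset[of _ "H \<times> H"]) (auto simp: finH)
  then have "(\<Union>(F, G)\<in>{(F, G). F \<in> H \<and> G \<in> H \<and> G \<noteq> F}. sweep (F \<inter> G) d t) \<in> null_sets lborel"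
    by (intro null_sets_UN' countable_finite) (auto intro!: sweep_ridge_null HF)
  moreover have "\<Union>H \<in> null_sets lborel"
    using null_sets_UN'[OF countable_finite[OF finH], of "\<lambda>F. F"] facet_null HF by simp
  ultimately have Z: "Z \<in> null_sets lborel"
    unfolding Z_def by (rule null_sets.Un[rotated])
  have int: "integrable lborel (\<lambda>x. indicator S x *\<^sub>R g x)" if "compact S" for S
    using that continuous_on_subset[OF g] by (intro borel_integrable_compact) auto
  have cK: "compact (sweep S d t)" if "S = K \<or> S \<in> H" for S
    using that compact compact_facet HF by (intro compact_sweep) auto
  have "indicator (sweep K d t) y = (indicator K y + (\<Sum>F\<in>H. indicator (sweep F d t) y) :: real)"
    if y: "y \<notin> Z" for y
  proof (cases "y \<in> sweep K d t")
    case False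
    then have "y \<notin> K" "\<forall>F\<in>H. y \<notin> sweep F d t"
      using mem_sweep_iff[OF t] by (auto simp: H_def)
    then show ?thesis
      using False by simp
  next
    case True
    \<comment> \<open>A point on a facet facing \<open>d\<close> leaves \<open>K\<close> at once
      when moved along \<open>d\<close>. Used twice with the roles exchanged, this makes the base
      points of one point in two prisms coincide.\<close>
    have le: "\<tau> \<le> 0" if "G \<in> H" "x \<in> G" "x + \<tau> *\<^sub>R d \<in> K" for G x \<tau>
    proof -
      have "\<tau> * (outward_normal K G \<bullet> d) \<le> 0"
        using below_level[OF HF[OF that(1)] that(3)] on_level[OF HF[OF that(1)] that(2)]
        by (simp add: inner_add_right)
      then show ?thesis
        using Hd[OF that(1)] by (simp add: mult_le_0_iff)
    qed
    show ?thesis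
    proof (cases "y \<in> K")
      case yK: True
      have "y \<notin> sweep F d t" if F: "F \<in> H" for F
      proof
        assume "y \<in> sweep F d t"
        then obtain x \<tau> where x: "x \<in> F" "0 \<le> \<tau>" "y = x + \<tau> *\<^sub>R d"
          by (auto simp: sweep_def)
        then have "\<tau> = 0"
          using le[OF F x(1)] yK by fastforce
        then show False
          using x y F by (auto simp: Z_def)
      qed
      then show ?thesis
        using True yK by simp
    next
      case yK: False
      then obtain F where F: "F \<in> H" "y \<in> sweep F d t"
        using True mem_sweep_iff[OF t] by (auto simp: H_def)
      have "y \<notin> sweep G d t" if G: "G \<in> H" "G \<noteq> F" for G
      proof
        assume "y \<in> sweep G d t"
        then obtain x \<tau> where x: "x \<in> G" "y = x + \<tau> *\<^sub>R d"
          by (auto simp: sweep_def)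
        obtain x' \<tau>' where x': "x' \<in> F" "0 \<le> \<tau>'" "\<tau>' \<le> t" "y = x' + \<tau>' *\<^sub>R d"
          using F(2) by (auto simp: sweep_def)
        have "x + (\<tau> - \<tau>') *\<^sub>R d = x'" "x' + (\<tau>' - \<tau>) *\<^sub>R d = x"
          using x(2) x'(4) by (simp_all add: algebra_simps)
        moreover have "x \<in> K" "x' \<in> K"
          using x(1) x'(1) F(1) G(1) HF facet_subset by blast+
        ultimately have "\<tau> - \<tau>' \<le> 0" "\<tau>' - \<tau> \<le> 0"
          using le[OF G(1) x(1), of "\<tau> - \<tau>'"] le[OF F(1) x'(1), of "\<tau>' - \<tau>"] by simp_all
        then have "x = x'"
          using x(2) x'(4) by simp
        then have "y \<in> sweep (F \<inter> G) d t"
          using x x' by (auto simp: sweep_def)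
        then show False
          using y F(1) G by (auto simp: Z_def)
      qed
      then have "(\<Sum>G\<in>H. indicator (sweep G d t) y) = (\<Sum>G\<in>H. if G = F then 1 else 0 :: real)"
        using F by (intro sum.cong) auto
      then show ?thesis
        using True yK F finH by simp
    qed
  qed
  then have "indicator (sweep K d t) y *\<^sub>R g y =
      indicator K y *\<^sub>R g y + (\<Sum>F\<in>H. indicator (sweep F d t) y *\<^sub>R g y)" if "y \<notin> Z" for y
    using that by (simp add: distrib_right sum_distrib_right)
  then have "AE y in lborel. indicator (sweep K d t) y *\<^sub>R g y =
      indicator K y *\<^sub>R g y + (\<Sum>F\<in>H. indicator (sweep F d t) y *\<^sub>R g y)"
    by (intro AE_I'[OF Z]) blast
  then have "(LINT x:sweep K d t|lborel. g x) =
      (\<integral>y. indicator K y *\<^sub>R g y + (\<Sum>F\<in>H. indicator (sweep F d t) y *\<^sub>R g y) \<partial>lborel)"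
    unfolding set_lebesgue_integral_def
    using int compact cK
    by (intro integral_cong_AE)
       (auto intro!: borel_measurable_add borel_measurable_sum intro: borel_measurable_integrable)
  also have "\<dots> = (LINT x:K|lborel. g x) + (\<Sum>F\<in>H. LINT x:sweep F d t|lborel. g x)"
    unfolding set_lebesgue_integral_def
    using int compact cK by (subst Bochner_Integration.integral_add) (auto intro!: integrable_sum simp: Bochner_Integration.integral_sum)
  finally show ?thesis
    by (simp add: H_def)
qed

text \<open>The map inside \<open>g\<close> is the identity on the plane of \<open>F\<close> and
  turns the normal \<open>\<nu>\<close> into \<open>t d\<close>, so it carries the straight prism
  onto the oblique one. Its Jacobian is
  \<open>1 + \<nu> \<bullet> (t d - \<nu>) = t (\<nu> \<bullet> d)\<close>.\<close>

lemma integral_sweep_facet: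
  fixes g :: "real^'n \<Rightarrow> real"
  assumes F: "F facet_of K" and t: "0 < t" and d: "0 < outward_normal K F \<bullet> d"
    and g: "continuous_on UNIV g"
  shows "(LINT x:sweep F d t|lborel. g x) = t * (outward_normal K F \<bullet> d) *
    (LINT y:sweep F (outward_normal K F) 1|lborel.
       g (y + (outward_normal K F \<bullet> y - level F) *\<^sub>R (t *\<^sub>R d - outward_normal K F)))"
proof -
  define \<nu> where "\<nu> = outward_normal K F"
  define u where "u = t *\<^sub>R d - \<nu>"
  define T where "T y = y + (\<nu> \<bullet> y - level F) *\<^sub>R u" for y
  have \<nu>: "norm \<nu> = 1" and \<nu>\<nu>: "\<nu> \<bullet> \<nu> = 1"
    using norm_outward_normal[OF F] outward_normal_inner_self[OF F] by (simp_all add: \<nu>_def)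
  have level: "\<nu> \<bullet> x = level F" if "x \<in> F" for x
    using on_level[OF F that] by (simp add: \<nu>_def)
  have det: "1 + \<nu> \<bullet> u = t * (\<nu> \<bullet> d)"
    by (simp add: u_def inner_diff_right \<nu>\<nu>)
  have pos: "0 < t * (\<nu> \<bullet> d)"
    using t d by (simp add: \<nu>_def)
  have T_\<nu>: "T (x + s *\<^sub>R \<nu>) = x + (s * t) *\<^sub>R d" if "x \<in> F" for x s
    using level[OF that] by (simp add: T_def inner_add_right \<nu>\<nu> u_def algebra_simps)
  have inner_T: "\<nu> \<bullet> T y - level F = (\<nu> \<bullet> y - level F) * (t * (\<nu> \<bullet> d))" for y
    unfolding det[symmetric] T_def by (simp add: inner_add_right algebra_simps)
  have inj: "y = y'" if "T y = T y'" for y y'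
  proof -
    have "\<nu> \<bullet> y - level F = \<nu> \<bullet> y' - level F"
      using inner_T[of y] inner_T[of y'] that pos by (metis less_irrefl mult_right_cancel)
    then show ?thesis
      using that by (simp add: T_def)
  qed
  have mem: "T y \<in> sweep F d t \<longleftrightarrow> y \<in> sweep F \<nu> 1" for y
  proof
    assume "T y \<in> sweep F d t"
    then obtain x \<tau> where x: "x \<in> F" "0 \<le> \<tau>" "\<tau> \<le> t" "T y = x + \<tau> *\<^sub>R d"
      by (auto simp: sweep_def)
    then have "T y = T (x + (\<tau> / t) *\<^sub>R \<nu>)"
      using t by (simp add: T_\<nu>)
    then have "y = x + (\<tau> / t) *\<^sub>R \<nu>"
      by (rule inj)
    moreover have "0 \<le> \<tau> / t" "\<tau> / t \<le> 1"
      using x t by simp_all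
    ultimately show "y \<in> sweep F \<nu> 1"
      unfolding sweep_def using x(1) by blast
  next
    assume "y \<in> sweep F \<nu> 1"
    then obtain x s where x: "x \<in> F" "0 \<le> s" "s \<le> 1" "y = x + s *\<^sub>R \<nu>"
      by (auto simp: sweep_def)
    have "T y = x + (s * t) *\<^sub>R d" "0 \<le> s * t" "s * t \<le> t"
      using x t by (simp_all add: T_\<nu> mult_left_le_one_le)
    then show "T y \<in> sweep F d t"
      using x(1) by (auto simp: sweep_def)
  qed
  have [measurable]: "sweep F d t \<in> sets borel" "g \<in> borel_measurable borel"
    using compact_facet[OF F] g
    by (auto intro!: borel_compact compact_sweep borel_measurable_continuous_onI)
  have "(LINT x:sweep F d t|lborel. g x) =
      \<bar>1 + \<nu> \<bullet> u\<bar> * (\<integral>y. indicator (sweep F d t) (T y) *\<^sub>R g (T y) \<partial>lborel)"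
    unfolding set_lebesgue_integral_def T_def
    using pos by (intro integral_lborel_rank_one_update \<nu>) (auto simp: det)
  also have "\<dots> = t * (\<nu> \<bullet> d) * (LINT y:sweep F \<nu> 1|lborel. g (T y))"
    unfolding set_lebesgue_integral_def det using pos
    by (auto simp: indicator_def mem intro!: Bochner_Integration.integral_cong)
  finally show ?thesis
    by (simp add: T_def u_def \<nu>_def)
qed

lemma face_int_facet:
  assumes F: "F facet_of K"
  shows "face_int (outward_normal K F) F g = (LINT y:sweep F (outward_normal K F) 1|lborel.
    g (y - (outward_normal K F \<bullet> y - level F) *\<^sub>R outward_normal K F))"
  by (simp add: face_int_def closest_point_facet[OF F] sweep_def)

text \<open>At step 0 the argument of \<open>g\<close> is the orthogonal projection onto the plane
  of \<open>F\<close>, as in \<open>face_int\<close>. The term with \<open>e\<close> allows for an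
  integrand that was translated together with the polytope.\<close>

lemma tendsto_sheared_face_int:
  fixes g :: "real^'n \<Rightarrow> real"
  assumes F: "F facet_of K" and g: "continuous_on UNIV g"
  defines "\<nu> \<equiv> outward_normal K F"
  shows "(\<lambda>n. LINT y:sweep F \<nu> 1|lborel.
      g (y + (\<nu> \<bullet> y - level F) *\<^sub>R (inverse (real (Suc n)) *\<^sub>R d - \<nu>) + inverse (real (Suc n)) *\<^sub>R e))
    \<longlonglongrightarrow> face_int \<nu> F g"
proof -
  have "continuous_on UNIV (\<lambda>(y, t). g (y + (\<nu> \<bullet> y - level F) *\<^sub>R (t *\<^sub>R d - \<nu>) + t *\<^sub>R e))"
    unfolding split_beta
    by (rule continuous_on_compose2[OF g]) (auto intro!: continuous_intros)
  from tendsto_set_lebesgue_integral_compact[OF compact_sweep[OF compact_facet[OF F]] this]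
  show ?thesis
    unfolding \<nu>_def face_int_facet[OF F] by simp
qed

proposition integral_directional_derivative:
  fixes g :: "real^'n \<Rightarrow> real"
  assumes g: "real_polynomial_function g"
  shows "(LINT x:K|lborel. frechet_derivative g (at x) d) =
    (\<Sum>F | F facet_of K. (outward_normal K F \<bullet> d) * face_int (outward_normal K F) F g)"
proof -
  let ?\<nu> = "outward_normal K"
  let ?P = "{F. F facet_of K \<and> 0 < ?\<nu> F \<bullet> d}"
  let ?N = "{F. F facet_of K \<and> 0 < ?\<nu> F \<bullet> (- d)}"
  let ?t = "\<lambda>n. inverse (real (Suc n))"
  \<comment> \<open>\<open>c\<close> is the sweeping direction. The extra shift \<open>e\<close> is
    0 for facets facing \<open>d\<close>, and \<open>d\<close> for those facing \<open>- d\<close>,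
    whose prisms start from the translated polytope.\<close>
  define A where "A F c e t = (LINT y:sweep F (?\<nu> F) 1|lborel.
      g (y + (?\<nu> F \<bullet> y - level F) *\<^sub>R (t *\<^sub>R c - ?\<nu> F) + t *\<^sub>R e))" for F c e t
  have cont: "continuous_on UNIV g"
    using g continuous_on_polymonial_function real_polynomial_function_eq by blast
  obtain q where q: "continuous_on UNIV (\<lambda>(x, t). q x t)" "\<And>x t. g (x + t *\<^sub>R d) - g x = t * q x t"
    using real_polynomial_function_difference_quotient[OF g] by metis
  have q_t: "continuous_on UNIV (q x)" for x
    using continuous_on_compose2[OF q(1), of UNIV "\<lambda>t. (x, t)"] by (simp add: continuous_intros)
  have deriv: "frechet_derivative g (at x) d = q x 0" for x
    using differentiable_at_real_polynomial_function[OF g] q_t q(2)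
    by (rule frechet_derivative_eq_difference_quotient)
  have step: "(LINT x:K|lborel. q x t) =
      (\<Sum>F\<in>?P. (?\<nu> F \<bullet> d) * A F d 0 t) + (\<Sum>F\<in>?N. (?\<nu> F \<bullet> d) * A F (- d) d t)" if t: "0 < t" for t
  proof -
    define g' where "g' = (\<lambda>x. g (x + t *\<^sub>R d))"
    have cont': "continuous_on UNIV g'"
      unfolding g'_def by (rule continuous_on_compose2[OF cont]) (auto intro!: continuous_intros)
    have intK: "set_integrable lborel K g" "set_integrable lborel K g'"
      using compact cont cont' by (auto intro!: set_integrable_lborel_compact intro: continuous_on_subset)
    \<comment> \<open>The same region swept backwards from its far end: translating
      \<open>sweep K (- d) t\<close> by \<open>t d\<close> gives \<open>sweep K d t\<close>.\<close>
    have "(LINT x:sweep K d t|lborel. g x) = (LINT x:sweep K (- d) t|lborel. g' x)"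
      unfolding g'_def
    proof (rule set_lebesgue_integral_translate[symmetric])
      show "sweep K d t \<in> sets borel"
        using compact by (intro borel_compact compact_sweep)
      show "g \<in> borel_measurable borel"
        using cont by (rule borel_measurable_continuous_onI)
      fix x
      show "x \<in> sweep K (- d) t \<longleftrightarrow> x + t *\<^sub>R d \<in> sweep K d t"
      proof
        assume "x \<in> sweep K (- d) t"
        then obtain z \<tau> where z: "z \<in> K" "0 \<le> \<tau>" "\<tau> \<le> t" "x = z + \<tau> *\<^sub>R (- d)"
          by (auto simp: sweep_def)
        then have "x + t *\<^sub>R d = z + (t - \<tau>) *\<^sub>R d" "0 \<le> t - \<tau>" "t - \<tau> \<le> t"
          by (auto simp: algebra_simps)
        then show "x + t *\<^sub>R d \<in> sweep K d t"
          unfolding sweep_def using z(1) by blast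
      next
        assume "x + t *\<^sub>R d \<in> sweep K d t"
        then obtain z \<tau> where z: "z \<in> K" "0 \<le> \<tau>" "\<tau> \<le> t" "x + t *\<^sub>R d = z + \<tau> *\<^sub>R d"
          by (auto simp: sweep_def)
        then have "x = z + \<tau> *\<^sub>R d - t *\<^sub>R d"
          by (metis add_diff_cancel_right')
        then have "x = z + (t - \<tau>) *\<^sub>R (- d)" "0 \<le> t - \<tau>" "t - \<tau> \<le> t"
          using z by (auto simp: algebra_simps)
        then show "x \<in> sweep K (- d) t"
          unfolding sweep_def using z(1) by blast
      qed
    qed
    also have "\<dots> = (LINT x:K|lborel. g' x) + (\<Sum>F\<in>?N. LINT x:sweep F (- d) t|lborel. g' x)"
      using t cont' by (intro integral_sweep) auto
    also have "(\<Sum>F\<in>?N. LINT x:sweep F (- d) t|lborel. g' x) = (\<Sum>F\<in>?N. t * (?\<nu> F \<bullet> (- d)) * A F (- d) d t)"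
      using t cont' by (intro sum.cong refl) (simp add: integral_sweep_facet A_def g'_def del: inner_minus_right)
    also have "(LINT x:sweep K d t|lborel. g x) = (LINT x:K|lborel. g x) + (\<Sum>F\<in>?P. LINT x:sweep F d t|lborel. g x)"
      using t cont by (intro integral_sweep) auto
    also have "(\<Sum>F\<in>?P. LINT x:sweep F d t|lborel. g x) = (\<Sum>F\<in>?P. t * (?\<nu> F \<bullet> d) * A F d 0 t)"
      using t cont by (intro sum.cong refl) (simp add: integral_sweep_facet A_def)
    finally have "(LINT x:K|lborel. g' x) - (LINT x:K|lborel. g x) =
        (\<Sum>F\<in>?P. t * (?\<nu> F \<bullet> d) * A F d 0 t) - (\<Sum>F\<in>?N. t * (?\<nu> F \<bullet> (- d)) * A F (- d) d t)"
      by linarith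
    also have "\<dots> = t * ((\<Sum>F\<in>?P. (?\<nu> F \<bullet> d) * A F d 0 t) + (\<Sum>F\<in>?N. (?\<nu> F \<bullet> d) * A F (- d) d t))"
      by (simp add: sum_distrib_left distrib_left sum_negf mult.assoc)
    also have "(LINT x:K|lborel. g' x) - (LINT x:K|lborel. g x) = (LINT x:K|lborel. g' x - g x)"
      using intK by (simp add: set_integral_diff)
    also have "\<dots> = t * (LINT x:K|lborel. q x t)"
      by (simp add: g'_def q(2))
    finally show ?thesis
      using t by simp
  qed
  have "(\<lambda>n. LINT x:K|lborel. q x (?t n)) \<longlonglongrightarrow> (LINT x:K|lborel. q x 0)"
    by (rule tendsto_set_lebesgue_integral_compact[OF compact q(1)])
  moreover have "(\<lambda>n. LINT x:K|lborel. q x (?t n)) \<longlonglongrightarrow>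
      (\<Sum>F\<in>?P. (?\<nu> F \<bullet> d) * face_int (?\<nu> F) F g) + (\<Sum>F\<in>?N. (?\<nu> F \<bullet> d) * face_int (?\<nu> F) F g)"
    unfolding step[of "?t n" for n, OF positive_imp_inverse_positive[OF of_nat_0_less_iff[THEN iffD2, OF zero_less_Suc]]] A_def
    using cont by (intro tendsto_intros tendsto_sheared_face_int) auto
  ultimately have "(LINT x:K|lborel. q x 0) =
      (\<Sum>F\<in>?P. (?\<nu> F \<bullet> d) * face_int (?\<nu> F) F g) + (\<Sum>F\<in>?N. (?\<nu> F \<bullet> d) * face_int (?\<nu> F) F g)"
    by (rule LIMSEQ_unique)
  also have "\<dots> = (\<Sum>F\<in>?P \<union> ?N. (?\<nu> F \<bullet> d) * face_int (?\<nu> F) F g)"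
    by (rule sum.union_disjoint[symmetric]) (auto intro: finite_subset[OF _ finite_facets])
  \<comment> \<open>Facets parallel to \<open>d\<close> are in neither index set, but they carry
    weight zero.\<close>
  also have "\<dots> = (\<Sum>F | F facet_of K. (?\<nu> F \<bullet> d) * face_int (?\<nu> F) F g)"
    by (rule sum.mono_neutral_left) (auto simp: finite_facets linorder_neq_iff)
  finally show ?thesis
    by (simp add: deriv)
qed

end

section \<open>Meshes\<close>

lemma translate_0 [simp]: "translate 0 F = F"
  by (simp add: translate_def)

lemma translate_translate [simp]: "translate t (translate s F) = translate (s + t) F"
  by (simp add: translate_def image_image add.assoc)

lemma mem_translateI: "x \<in> F \<Longrightarrow> x + s \<in> translate s F"
  by (simp add: translate_def)

lemma mem_translate_iff: "x \<in> translate s F \<longleftrightarrow> x - s \<in> F"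
  by (auto simp: translate_def image_iff) (metis diff_add_cancel)

locale fem_mesh =
  fixes \<Omega> :: "(real^'n::finite) set" and M :: "'n mesh"
  assumes fe_mesh: "fe_mesh \<Omega> M"
begin

lemma finite_cells: "finite (cells M)"
  using fe_mesh by (simp add: fe_mesh_def conforming_mesh_def)

lemma solid_cell: "K \<in> cells M \<Longrightarrow> solid_polytope K"
  using fe_mesh by (simp add: fe_mesh_def conforming_mesh_def solid_polytope_def)

lemma interiors_disjoint:
  "K \<in> cells M \<Longrightarrow> K' \<in> cells M \<Longrightarrow> K \<noteq> K' \<Longrightarrow> interior K \<inter> interior K' = {}"
  using fe_mesh by (simp add: fe_mesh_def conforming_mesh_def)

text \<open>Periodic faces are outer faces of some cell, and an outer face belongs to one cell only,
  so that cell must be \<open>K\<close>.\<close>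

lemma pface_outer: "F \<in> pfaces M \<Longrightarrow> K \<in> cells M \<Longrightarrow> F facet_of K \<Longrightarrow> (K, F) \<in> outer_faces M"
proof -
  assume F: "F \<in> pfaces M" "K \<in> cells M" "F facet_of K"
  obtain K0 where "(K0, F) \<in> outer_faces M"
    using fe_mesh F(1) by (auto simp: fe_mesh_def periodic_identification_def)
  then show ?thesis
    using F by (auto simp: outer_faces_def)
qed

lemma pface_partner:
  assumes "F \<in> pfaces M"
  shows "translate (pshift M F) F \<in> pfaces M"
    and "pshift M (translate (pshift M F) F) = - pshift M F"
    and "\<And>K K'. (K, F) \<in> outer_faces M \<Longrightarrow> (K', translate (pshift M F) F) \<in> outer_faces M \<Longrightarrow>
      outward_normal K' (translate (pshift M F) F) = - outward_normal K F"
  using fe_mesh assms by (auto simp: fe_mesh_def periodic_identification_def Let_def)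

text \<open>The normals agree up to sign, and equal normals would make the interiors of two distinct
  cells meet.\<close>

lemma opposite_normals:
  assumes K: "K \<in> cells M" "F facet_of K" and K': "K' \<in> cells M" "F facet_of K'" and ne: "K \<noteq> K'"
  shows "outward_normal K' F = - outward_normal K F"
proof -
  note solid = solid_cell[OF K(1)] K(2) solid_cell[OF K'(1)] K'(2)
  have "outward_normal K' F \<noteq> outward_normal K F"
    using interiors_meet_if_same_facet_normal[OF solid] interiors_disjoint[OF K(1) K'(1) ne] by blast
  then show ?thesis
    using common_facet_normal[OF solid] by blast
qed

lemma interface:
  assumes "(K, F, K', s) \<in> interfaces M"
  shows "K \<in> cells M" "K' \<in> cells M" "F facet_of K" "translate s F facet_of K'"
  using assms by (auto simp: interfaces_def)

text \<open>The alternatives in \<open>interfaces\<close> exclude each other: a periodic face has a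
  single cell, so it cannot also be shared by two distinct cells with \<open>s = 0\<close>.\<close>

lemma interface_cases:
  assumes "(K, F, K', s) \<in> interfaces M"
  obtains "K \<noteq> K'" "s = 0" "F \<notin> pfaces M"
  | "F \<in> pfaces M" "s = pshift M F" "(K, F) \<in> outer_faces M" "(K', translate s F) \<in> outer_faces M"
proof (cases "F \<in> pfaces M")
  case True
  then have K: "(K, F) \<in> outer_faces M"
    using interface[OF assms] pface_outer by blast
  have "s = pshift M F"
  proof (rule ccontr)
    assume "s \<noteq> pshift M F"
    then have "K \<noteq> K'" "s = 0"
      using assms by (auto simp: interfaces_def)
    then show False
      using K interface(2,4)[OF assms] by (auto simp: outer_faces_def)
  qed
  then show ?thesis
    using that(2) True K pface_partner(1)[OF True] pface_outer interface[OF assms] by blast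
next
  case False
  then show ?thesis
    using that(1) assms by (auto simp: interfaces_def)
qed

lemma interface_normal:
  assumes "(K, F, K', s) \<in> interfaces M"
  shows "outward_normal K' (translate s F) = - outward_normal K F"
  using assms
proof (cases rule: interface_cases)
  case 1
  then show ?thesis
    using opposite_normals[OF interface(1,3,2)[OF assms]] interface(4)[OF assms] by simp
next
  case 2
  then show ?thesis
    using pface_partner(3) by simp
qed

lemma interface_flip:
  assumes "(K, F, K', s) \<in> interfaces M"
  shows "(K', translate s F, K, - s) \<in> interfaces M"
  using assms
proof (cases rule: interface_cases)
  case 1
  then show ?thesis
    using assms by (auto simp: interfaces_def)
next
  case 2
  then show ?thesis
    using interface[OF assms] pface_partner[of F] by (auto simp: interfaces_def)
qed

text \<open>A third cell at \<open>F\<close> would have the same normal there as the second, and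
  their interiors would meet. On a periodic face the translated outer face determines its cell.
  Hence \<open>(K, F)\<close> can index the interfaces.\<close>

lemma interface_unique:
  assumes 1: "(K, F, K1, s1) \<in> interfaces M" and 2: "(K, F, K2, s2) \<in> interfaces M"
  shows "K1 = K2 \<and> s1 = s2"
  using 1
proof (cases rule: interface_cases)
  case c1: 1
  from 2 show ?thesis
  proof (cases rule: interface_cases)
    case c2: 1
    have "outward_normal K2 F = outward_normal K1 F"
      using interface_normal[OF 1] interface_normal[OF 2] c1 c2 by simp
    then have "interior K1 \<inter> interior K2 \<noteq> {}"
      using interface(4)[OF 1] interface(4)[OF 2] c1 c2
      by (intro interiors_meet_if_same_facet_normal[of K1 F K2] solid_cell
          interface(2)[OF 1] interface(2)[OF 2]) simp_all
    then show ?thesis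
      using interiors_disjoint[OF interface(2)[OF 1] interface(2)[OF 2]] c1(2) c2(2) by blast
  qed (use c1 in blast)
next
  case c1: 2
  from 2 show ?thesis
  proof (cases rule: interface_cases)
    case c2: 2
    have "K2 = K1"
      using c1(2,4) c2(2) interface(2,4)[OF 2] unfolding outer_faces_def by blast
    then show ?thesis
      using c1(2) c2(2) by simp
  qed (use c1 in blast)
qed

definition faces :: "((real^'n) set \<times> (real^'n) set) set" where
  "faces = (SIGMA K:cells M. {F. F facet_of K})"

lemma finite_faces: "finite faces"
  unfolding faces_def
  by (intro finite_SigmaI finite_cells) (simp add: solid_polytope.finite_facets[OF solid_cell])

lemma face_cases:
  assumes "(K, F) \<in> faces"
  obtains "(K, F) \<in> boundary_faces M" | K' s where "(K, F, K', s) \<in> interfaces M"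
proof -
  have KF: "K \<in> cells M" "F facet_of K"
    using assms by (auto simp: faces_def)
  show ?thesis
  proof (cases "F \<in> pfaces M")
    case True
    let ?F' = "translate (pshift M F) F"
    have "?F' \<in> pfaces M"
      by (rule pface_partner(1)[OF True])
    then obtain K' where "(K', ?F') \<in> outer_faces M"
      using fe_mesh by (auto simp: fe_mesh_def periodic_identification_def)
    then have "(K, F, K', pshift M F) \<in> interfaces M"
      using KF True by (auto simp: interfaces_def outer_faces_def)
    then show ?thesis by (rule that(2))
  next
    case False
    show ?thesis
    proof (cases "(K, F) \<in> outer_faces M")
      case True
      then show ?thesis
        using False that(1) by (simp add: boundary_faces_def)
    next
      case outer: False
      then obtain K' where "K' \<in> cells M" "F facet_of K'" "K' \<noteq> K"
        using KF by (auto simp: outer_faces_def)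
      then have "(K, F, K', 0) \<in> interfaces M"
        using KF by (auto simp: interfaces_def)
      then show ?thesis by (rule that(2))
    qed
  qed
qed

lemma interface_fnormal:
  assumes "(K, F, K', s) \<in> interfaces M"
  shows "fnormal M F = outward_normal K F \<or> fnormal M F = - outward_normal K F"
    and "fnormal M (translate s F) = fnormal M F"
proof -
  have "\<forall>(K, F, K', s)\<in>interfaces M.
     (fnormal M F = outward_normal K F \<or> fnormal M F = - outward_normal K F) \<and>
     fnormal M (translate s F) = fnormal M F"
    using fe_mesh by (simp add: fe_mesh_def oriented_def)
  from bspec[OF this assms]
  show "fnormal M F = outward_normal K F \<or> fnormal M F = - outward_normal K F"
    and "fnormal M (translate s F) = fnormal M F" by simp_all
qed

lemma finite_interfaces: "finite (interfaces M)"
proof -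
  have "inj_on (\<lambda>(K, F, K', s). (K, F)) (interfaces M)"
    by (auto simp: inj_on_def dest: interface_unique)
  moreover have "(\<lambda>(K, F, K', s). (K, F)) ` interfaces M \<subseteq> faces"
    using interface by (fastforce simp: faces_def)
  ultimately show ?thesis
    using finite_faces finite_subset finite_imageD by metis
qed

text \<open>Exchanging the sides is an involution on \<open>interfaces\<close> that reverses the
  outward normal but keeps \<open>fnormal\<close>, so it swaps \<open>\<Gamma> M\<close> with its
  complement.\<close>

lemma sum_faces_eq_sum_\<Gamma>:
  fixes J :: "(real^'n) set \<Rightarrow> (real^'n) set \<Rightarrow> real"
  assumes bdry: "\<And>K F. (K, F) \<in> boundary_faces M \<Longrightarrow> J K F = 0"
  shows "(\<Sum>K\<in>cells M. \<Sum>F | F facet_of K. J K F) =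
    (\<Sum>(K, F, K', s)\<in>\<Gamma> M. J K F + J K' (translate s F))"
proof -
  define flip :: "(real^'n) set \<times> (real^'n) set \<times> (real^'n) set \<times> (real^'n) \<Rightarrow> _" where
    "flip = (\<lambda>(K, F, K', s). (K', translate s F, K, - s))"
  define \<Gamma>' where "\<Gamma>' = interfaces M - \<Gamma> M"
  define J' where "J' = (\<lambda>(K, F, K' :: (real^'n) set, s :: real^'n). J K F)"
  \<comment> \<open>A unit vector differs from its negative, so \<open>fnormal\<close> is the
    outward normal for exactly one of the two orders.\<close>
  have nz: "outward_normal K F \<noteq> - outward_normal K F" if "(K, F, K', s) \<in> interfaces M" for K F K' s
  proof
    interpret solid_polytope K
      using interface[OF that] solid_cell by blast
    assume "outward_normal K F = - outward_normal K F"
    then have "outward_normal K F = 0"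
      by (simp add: eq_neg_iff_add_eq_0 flip: scaleR_2)
    then show False
      using norm_outward_normal[OF interface(3)[OF that]] by simp
  qed
  have flip_\<Gamma>: "flip i \<in> \<Gamma>'" if "i \<in> \<Gamma> M" for i
  proof -
    obtain K F K' s where i: "i = (K, F, K', s)" by (cases i)
    then have *: "(K, F, K', s) \<in> interfaces M" "fnormal M F = outward_normal K F"
      using that by (auto simp: \<Gamma>_def)
    then show ?thesis
      using interface_flip[OF *(1)] interface_normal[OF *(1)] interface_fnormal(2)[OF *(1)] nz[OF *(1)]
      by (auto simp: i flip_def \<Gamma>'_def \<Gamma>_def)
  qed
  have flip_\<Gamma>': "flip i \<in> \<Gamma> M" if "i \<in> \<Gamma>'" for i
  proof -
    obtain K F K' s where i: "i = (K, F, K', s)" by (cases i)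
    then have *: "(K, F, K', s) \<in> interfaces M" "fnormal M F \<noteq> outward_normal K F"
      using that by (auto simp: \<Gamma>'_def \<Gamma>_def)
    then show ?thesis
      using interface_flip[OF *(1)] interface_normal[OF *(1)] interface_fnormal[OF *(1)]
      by (auto simp: i flip_def \<Gamma>_def)
  qed
  have flip_flip: "flip (flip i) = i" for i
    by (cases i) (simp add: flip_def)
  have bij: "bij_betw flip (\<Gamma> M) \<Gamma>'"
    by (rule bij_betwI[where g = flip]) (auto simp: flip_\<Gamma> flip_\<Gamma>' flip_flip)
  have split: "interfaces M = \<Gamma> M \<union> \<Gamma>'" "\<Gamma> M \<inter> \<Gamma>' = {}"
    by (auto simp: \<Gamma>'_def \<Gamma>_def)
  have fin: "finite (\<Gamma> M)" "finite \<Gamma>'"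
    using finite_interfaces split by (metis finite_Un)+
  have inj: "inj_on (\<lambda>(K, F, K', s). (K, F)) (interfaces M)"
    by (auto simp: inj_on_def dest: interface_unique)
  have "(\<Sum>K\<in>cells M. \<Sum>F | F facet_of K. J K F) = (\<Sum>(K, F)\<in>faces. J K F)"
    unfolding faces_def
    by (rule sum.Sigma) (auto simp: finite_cells solid_cell solid_polytope.finite_facets)
  also have "\<dots> = (\<Sum>(K, F)\<in>(\<lambda>(K, F, K', s). (K, F)) ` interfaces M. J K F)"
  proof (rule sum.mono_neutral_right[OF finite_faces])
    show "(\<lambda>(K, F, K', s). (K, F)) ` interfaces M \<subseteq> faces"
      using interface by (fastforce simp: faces_def)
    show "\<forall>i\<in>faces - (\<lambda>(K, F, K', s). (K, F)) ` interfaces M. (case i of (K, F) \<Rightarrow> J K F) = 0"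
    proof safe
      fix K F
      assume "(K, F) \<in> faces" "(K, F) \<notin> (\<lambda>(K, F, K', s). (K, F)) ` interfaces M"
      then show "J K F = 0"
        by (cases rule: face_cases) (force simp: bdry)+
    qed
  qed
  also have "\<dots> = (\<Sum>i\<in>interfaces M. J' i)"
    by (subst sum.reindex[OF inj]) (simp add: J'_def case_prod_unfold)
  also have "\<dots> = (\<Sum>i\<in>\<Gamma> M. J' i) + (\<Sum>i\<in>\<Gamma>'. J' i)"
    using fin split by (simp add: sum.union_disjoint)
  also have "(\<Sum>i\<in>\<Gamma>'. J' i) = (\<Sum>i\<in>\<Gamma> M. J' (flip i))"
    by (rule sum.reindex_bij_betw[OF bij, symmetric])
  finally show ?thesis
    by (simp add: sum.distrib[symmetric] J'_def flip_def case_prod_unfold)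
qed

end

section \<open>Surface integrals\<close>

lemma face_int_cmult: "face_int \<nu> F (\<lambda>x. c * g x) = c * face_int \<nu> F g"
  by (simp add: face_int_def)

lemma face_int_zero: "face_int \<nu> F (\<lambda>x. 0) = 0"
  by (simp add: face_int_def)

context solid_polytope
begin

lemma closest_point_facet_mem:
  assumes F: "F facet_of K" and y: "y \<in> sweep F (outward_normal K F) 1"
  shows "y - (outward_normal K F \<bullet> y - level F) *\<^sub>R outward_normal K F \<in> F"
proof -
  obtain x \<tau> where x: "x \<in> F" "y = x + \<tau> *\<^sub>R outward_normal K F"
    using y by (auto simp: sweep_def)
  have "outward_normal K F \<bullet> y - level F = \<tau>"
    using x on_level[OF F x(1)] by (simp add: inner_add_right outward_normal_inner_self[OF F])
  then show ?thesis
    using x by simp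
qed

text \<open>The prism projects into \<open>F\<close> itself. This lets boundary conditions and
  continuity, which hold only on the face, act inside the integral.\<close>

lemma face_int_cong:
  assumes F: "F facet_of K" and gh: "\<And>x. x \<in> F \<Longrightarrow> g x = h x"
  shows "face_int (outward_normal K F) F g = face_int (outward_normal K F) F h"
  unfolding face_int_facet[OF F] set_lebesgue_integral_def
  by (intro Bochner_Integration.integral_cong)
     (auto simp: indicator_def gh closest_point_facet_mem[OF F])

lemma set_integrable_face:
  fixes g :: "real^'n \<Rightarrow> real"
  assumes F: "F facet_of K" and g: "continuous_on UNIV g"
  shows "set_integrable lborel (sweep F (outward_normal K F) 1)
    (\<lambda>y. g (y - (outward_normal K F \<bullet> y - level F) *\<^sub>R outward_normal K F))"
  by (intro set_integrable_lborel_compact compact_sweep compact_facet[OF F]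
      continuous_on_compose2[OF g]) (auto intro!: continuous_intros)

lemma face_int_diff:
  assumes F: "F facet_of K" and "continuous_on UNIV g" "continuous_on UNIV h"
  shows "face_int (outward_normal K F) F (\<lambda>x. g x - h x) =
    face_int (outward_normal K F) F g - face_int (outward_normal K F) F h"
  unfolding face_int_facet[OF F]
  using assms by (intro set_integral_diff(2) set_integrable_face)

lemma face_int_sum:
  assumes F: "F facet_of K" and "\<And>i. i \<in> I \<Longrightarrow> continuous_on UNIV (g i)"
  shows "face_int (outward_normal K F) F (\<lambda>x. \<Sum>i\<in>I. g i x) =
    (\<Sum>i\<in>I. face_int (outward_normal K F) F (g i))"
  unfolding face_int_facet[OF F] set_lebesgue_integral_def scaleR_sum_right
  using set_integrable_face[OF F] assms(2) unfolding set_integrable_def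
  by (intro Bochner_Integration.integral_sum) auto

end

text \<open>The partner prism is erected on the opposite side of its face. Shifting by
  \<open>s - \<nu>\<close> matches the two prisms and turns height \<open>\<tau>\<close> into
  \<open>1 - \<tau>\<close>, which the projection does not see.\<close>

lemma face_int_translate:
  fixes g :: "real^'n \<Rightarrow> real"
  assumes K: "solid_polytope K" "F facet_of K" and K': "solid_polytope K'" "translate s F facet_of K'"
    and opp: "outward_normal K' (translate s F) = - outward_normal K F"
    and g: "continuous_on UNIV g"
  shows "face_int (outward_normal K' (translate s F)) (translate s F) g =
    face_int (outward_normal K F) F (\<lambda>x. g (x + s))"
proof -
  interpret K: solid_polytope K by fact
  interpret K': solid_polytope K' by fact
  let ?\<nu> = "outward_normal K F" and ?F' = "translate s F"
  obtain x where x: "x \<in> F"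
    using K.facet_nonempty[OF K(2)] by blast
  have lev: "K'.level ?F' = - (K.level F + ?\<nu> \<bullet> s)"
    using K.on_level[OF K(2) x] K'.on_level[OF K'(2) mem_translateI[OF x]]
    by (simp add: opp inner_add_right)
  define f where "f y = g (y - (- ?\<nu> \<bullet> y - K'.level ?F') *\<^sub>R (- ?\<nu>))" for y
  have f_shift: "f (y + (s - ?\<nu>)) = g (y - (?\<nu> \<bullet> y - K.level F) *\<^sub>R ?\<nu> + s)" for y
    by (simp add: f_def lev inner_add_right inner_diff_right K.outward_normal_inner_self[OF K(2)] algebra_simps)
  have "continuous_on UNIV f"
    unfolding f_def by (intro continuous_on_compose2[OF g]) (auto intro!: continuous_intros)
  then have [measurable]: "f \<in> borel_measurable borel"
    by (rule borel_measurable_continuous_onI)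
  have mem: "y \<in> sweep F ?\<nu> 1 \<longleftrightarrow> y + (s - ?\<nu>) \<in> sweep ?F' (- ?\<nu>) 1" for y
  proof
    assume "y \<in> sweep F ?\<nu> 1"
    then obtain z \<tau> where z: "z \<in> F" "0 \<le> \<tau>" "\<tau> \<le> 1" "y = z + \<tau> *\<^sub>R ?\<nu>"
      by (auto simp: sweep_def)
    then have "y + (s - ?\<nu>) = (z + s) + (1 - \<tau>) *\<^sub>R (- ?\<nu>)" "0 \<le> 1 - \<tau>" "1 - \<tau> \<le> 1"
      by (auto simp: algebra_simps)
    moreover have "z + s \<in> ?F'"
      using z(1) by (rule mem_translateI)
    ultimately show "y + (s - ?\<nu>) \<in> sweep ?F' (- ?\<nu>) 1"
      unfolding sweep_def by blast
  next
    assume "y + (s - ?\<nu>) \<in> sweep ?F' (- ?\<nu>) 1"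
    then obtain z \<tau> where z: "z \<in> ?F'" "0 \<le> \<tau>" "\<tau> \<le> 1" "y + (s - ?\<nu>) = z + \<tau> *\<^sub>R (- ?\<nu>)"
      unfolding sweep_def by blast
    then have "y = z + \<tau> *\<^sub>R (- ?\<nu>) - (s - ?\<nu>)"
      by (metis add_diff_cancel_right')
    then have "y = (z - s) + (1 - \<tau>) *\<^sub>R ?\<nu>" "0 \<le> 1 - \<tau>" "1 - \<tau> \<le> 1"
      using z by (auto simp: algebra_simps)
    moreover have "z - s \<in> F"
      using z(1) by (simp add: mem_translate_iff)
    ultimately show "y \<in> sweep F ?\<nu> 1"
      unfolding sweep_def by blast
  qed
  have "face_int (outward_normal K' ?F') ?F' g = (LINT y:sweep ?F' (- ?\<nu>) 1|lborel. f y)"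
    by (simp only: opp f_def K'.face_int_facet[OF K'(2), unfolded opp])
  also have "\<dots> = (LINT y:sweep F ?\<nu> 1|lborel. f (y + (s - ?\<nu>)))"
    by (intro set_lebesgue_integral_translate[symmetric] mem)
       (use K'.compact_facet[OF K'(2)] in \<open>auto intro!: borel_compact compact_sweep\<close>)
  also have "\<dots> = face_int ?\<nu> F (\<lambda>x. g (x + s))"
    unfolding K.face_int_facet[OF K(2)] f_shift ..
  finally show ?thesis .
qed

section \<open>Piecewise polynomials\<close>

lemma finite_multi_indices: "finite {\<alpha> :: 'n::finite \<Rightarrow> nat. (\<Sum>i\<in>UNIV. \<alpha> i) \<le> q}"
proof (rule finite_subset)
  have "\<alpha> i \<le> (\<Sum>i\<in>UNIV. \<alpha> i)" for \<alpha> :: "'n \<Rightarrow> nat" and i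
    by (rule member_le_sum) auto
  then show "{\<alpha> :: 'n \<Rightarrow> nat. (\<Sum>i\<in>UNIV. \<alpha> i) \<le> q} \<subseteq>
      {\<alpha>. \<forall>x. (x \<in> UNIV \<longrightarrow> \<alpha> x \<in> {..q}) \<and> (x \<notin> UNIV \<longrightarrow> \<alpha> x = 0)}"
    by (auto intro: order_trans)
qed (rule finite_set_of_finite_funs; simp)

lemma poly_le_imp_real_polynomial_function:
  assumes "poly_le q f"
  shows "real_polynomial_function f"
proof -
  obtain c where c: "\<And>x. f x = (\<Sum>\<alpha> | (\<Sum>i\<in>UNIV. \<alpha> i) \<le> q. c \<alpha> * (\<Prod>i\<in>UNIV. (x $ i) ^ (\<alpha> i :: nat)))"
    using assms unfolding poly_le_def by blast
  have "real_polynomial_function (\<lambda>x::real^'a. x $ i)" for i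
    by (rule real_polynomial_function.intros(1)) (rule bounded_linear_vec_nth)
  then have "real_polynomial_function (\<lambda>x. \<Sum>\<alpha> | (\<Sum>i\<in>UNIV. \<alpha> i) \<le> q. c \<alpha> * (\<Prod>i\<in>UNIV. (x $ i) ^ (\<alpha> i)))"
    by (intro real_polynomial_function_sum finite_multi_indices real_polynomial_function.intros(4)
        real_polynomial_function.intros(2) real_polynomial_function_prod real_polynomial_function_power) auto
  then show ?thesis
    using c by presburger
qed

lemma poly_le_mono:
  assumes "poly_le p f" "p \<le> q"
  shows "poly_le q f"
proof -
  obtain c where c: "\<And>x. f x = (\<Sum>\<alpha> | (\<Sum>i\<in>UNIV. \<alpha> i) \<le> p. c \<alpha> * (\<Prod>i\<in>UNIV. (x $ i) ^ (\<alpha> i :: nat)))"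
    using assms unfolding poly_le_def by blast
  define c' where "c' \<alpha> = (if (\<Sum>i\<in>UNIV. \<alpha> i) \<le> p then c \<alpha> else 0)" for \<alpha>
  have "f x = (\<Sum>\<alpha> | (\<Sum>i\<in>UNIV. \<alpha> i) \<le> q. c' \<alpha> * (\<Prod>i\<in>UNIV. (x $ i) ^ (\<alpha> i)))" for x
    unfolding c
    by (rule sum.mono_neutral_cong_left) (use assms(2) in \<open>auto simp: finite_multi_indices c'_def\<close>)
  then show ?thesis
    unfolding poly_le_def by blast
qed

lemma poly_le_lincomb:
  assumes "\<And>j. j < m \<Longrightarrow> poly_le q (e j)"
  shows "poly_le q (\<lambda>x. \<Sum>j<m. y j * e j x)"
proof -
  have "\<forall>j. \<exists>c. j < m \<longrightarrow> (\<forall>x. e j x = (\<Sum>\<alpha> | (\<Sum>i\<in>UNIV. \<alpha> i) \<le> q. c \<alpha> * (\<Prod>i\<in>UNIV. (x $ i) ^ (\<alpha> i :: nat))))"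
    using assms unfolding poly_le_def by blast
  from choice[OF this] obtain c where c: "\<And>j x. j < m \<Longrightarrow>
      e j x = (\<Sum>\<alpha> | (\<Sum>i\<in>UNIV. \<alpha> i) \<le> q. c j \<alpha> * (\<Prod>i\<in>UNIV. (x $ i) ^ (\<alpha> i :: nat)))"
    by blast
  have *: "(\<Sum>j<m. y j * e j x) =
      (\<Sum>\<alpha> | (\<Sum>i\<in>UNIV. \<alpha> i) \<le> q. (\<Sum>j<m. y j * c j \<alpha>) * (\<Prod>i\<in>UNIV. (x $ i) ^ (\<alpha> i)))" for x
    by (simp add: c sum_distrib_left sum_distrib_right mult.assoc) (rule sum.swap)
  show ?thesis
    unfolding poly_le_def
    by (rule exI[where x = "\<lambda>\<alpha>. \<Sum>j<m. y j * c j \<alpha>"]) (rule allI, rule *)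
qed

lemma L2_space_polynomial:
  "f \<in> L2_space M q \<Longrightarrow> K \<in> cells M \<Longrightarrow> real_polynomial_function (f K)"
  by (auto simp: L2_space_def intro: poly_le_imp_real_polynomial_function)

lemma L2_space_boundary:
  "f \<in> L2_space M q \<Longrightarrow> (K, F) \<in> boundary_faces M \<Longrightarrow> x \<in> F \<Longrightarrow> f K x = 0"
  by (auto simp: L2_space_def)

lemma H1_space_continuous:
  "f \<in> H1_space M q \<Longrightarrow> (K, F, K', s) \<in> interfaces M \<Longrightarrow> x \<in> F \<Longrightarrow> f K x = f K' (x + s)"
  by (auto simp: H1_space_def)

lemma H1_space_subset_L2_space: "H1_space M q \<subseteq> L2_space M q"
  by (auto simp: H1_space_def)

lemma L2_space_mono: "p \<le> q \<Longrightarrow> L2_space M p \<subseteq> L2_space M q"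
  by (auto simp: L2_space_def intro: poly_le_mono)

lemma H1_space_mono: "p \<le> q \<Longrightarrow> H1_space M p \<subseteq> H1_space M q"
  using L2_space_mono[of p q M] by (auto simp: H1_space_def)

lemma lincomb_in_L2_space:
  assumes "\<And>j. j < m \<Longrightarrow> e j \<in> L2_space M q"
  shows "lincomb m e y \<in> L2_space M q"
proof -
  have "poly_le q (lincomb m e y K)" if "K \<in> cells M" for K
    using assms that unfolding lincomb_def L2_space_def by (intro poly_le_lincomb) simp
  moreover have "lincomb m e y K = (\<lambda>x. 0)" if "K \<notin> cells M" for K
    using assms that by (simp add: lincomb_def L2_space_def)
  moreover have "lincomb m e y K x = 0" if "(K, F) \<in> boundary_faces M" "x \<in> F" for K F x
    using L2_space_boundary[OF assms that] by (simp add: lincomb_def)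
  ultimately show ?thesis
    unfolding L2_space_def by blast
qed

lemma lincomb_in_H1_space:
  assumes "\<And>j. j < m \<Longrightarrow> e j \<in> H1_space M q"
  shows "lincomb m e y \<in> H1_space M q"
proof -
  have "lincomb m e y \<in> L2_space M q"
    using assms H1_space_subset_L2_space by (blast intro: lincomb_in_L2_space)
  moreover have "lincomb m e y K x = lincomb m e y K' (x + s)"
    if "(K, F, K', s) \<in> interfaces M" "x \<in> F" for K F K' s x
    unfolding lincomb_def using H1_space_continuous[OF assms that] by (intro sum.cong) auto
  ultimately show ?thesis
    by (auto simp: H1_space_def)
qed

section \<open>Derivatives of polynomials and the divergence theorem\<close>

lemma continuous_on_real_polynomial_function:
  "real_polynomial_function g \<Longrightarrow> continuous_on S g"
  by (simp add: continuous_on_polymonial_function real_polynomial_function_eq)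

lemma continuous_on_frechet_derivative_polynomial:
  fixes g :: "'a::real_normed_vector \<Rightarrow> real"
  assumes g: "real_polynomial_function g"
  shows "continuous_on S (\<lambda>x. frechet_derivative g (at x) d)"
proof -
  obtain q where q: "continuous_on UNIV (\<lambda>(x, t). q x t)" "\<And>x t. g (x + t *\<^sub>R d) - g x = t * q x t"
    using real_polynomial_function_difference_quotient[OF g] by metis
  have "frechet_derivative g (at x) d = q x 0" for x
  proof (rule frechet_derivative_eq_difference_quotient)
    show "continuous_on UNIV (q x)"
      using continuous_on_compose2[OF q(1), of UNIV "\<lambda>t. (x, t)"] by (simp add: continuous_intros)
  qed (use differentiable_at_real_polynomial_function[OF g] q(2) in auto)
  moreover have "continuous_on S (\<lambda>x. q x 0)"
    using continuous_on_compose2[OF q(1), of S "\<lambda>x. (x, 0)"] by (simp add: continuous_intros)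
  ultimately show ?thesis
    by simp
qed

lemma frechet_derivative_mult_real:
  fixes f g :: "'a::real_normed_vector \<Rightarrow> real"
  assumes "f differentiable (at x)" "g differentiable (at x)"
  shows "frechet_derivative (\<lambda>y. f y * g y) (at x) d =
    f x * frechet_derivative g (at x) d + frechet_derivative f (at x) d * g x"
  using has_derivative_mult[OF assms[unfolded frechet_derivative_works]]
  by (simp add: frechet_derivative_at[symmetric])

lemma frechet_derivative_inner_const:
  fixes P :: "'a::real_normed_vector \<Rightarrow> 'b::real_inner"
  assumes "P differentiable (at x)"
  shows "frechet_derivative (\<lambda>y. P y \<bullet> a) (at x) d = frechet_derivative P (at x) d \<bullet> a"
  using has_derivative_inner_left[OF assms[unfolded frechet_derivative_works], of a]
  by (simp add: frechet_derivative_at[symmetric])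

lemma linear_sum_axis:
  fixes L :: "real^'n \<Rightarrow> 'b::real_vector"
  assumes "linear L"
  shows "L \<nu> = (\<Sum>i\<in>UNIV. (\<nu> $ i) *\<^sub>R L (axis i 1))"
proof -
  have "\<nu> = (\<Sum>i\<in>UNIV. (\<nu> $ i) *\<^sub>R axis i 1)"
    by (simp add: vec_eq_iff axis_def if_distrib cong: if_cong)
  then have "L \<nu> = L (\<Sum>i\<in>UNIV. (\<nu> $ i) *\<^sub>R axis i 1)"
    by simp
  then show ?thesis
    by (simp add: linear_sum[OF assms] linear_scale[OF assms])
qed

context solid_polytope
begin

text \<open>The component along \<open>L (axis i 1)\<close> contributes its facet integrals with
  weight \<open>\<nu> $ i\<close>; linearity of \<open>L\<close> collects them into
  \<open>P x \<bullet> L \<nu>\<close>. With \<open>L = emb D\<close> this also covers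
  three-component fields on planar cells.\<close>

proposition divergence_theorem:
  fixes P :: "real^'n \<Rightarrow> 'b::euclidean_space"
  assumes L: "linear L" and P: "polynomial_function P" and g: "real_polynomial_function g"
  shows "(LINT x:K|lborel. \<Sum>i\<in>UNIV. frechet_derivative (\<lambda>y. g y * (P y \<bullet> L (axis i 1))) (at x) (axis i 1)) =
    (\<Sum>F | F facet_of K. face_int (outward_normal K F) F (\<lambda>x. g x * (P x \<bullet> L (outward_normal K F))))"
proof -
  define U where "U i = (\<lambda>y. g y * (P y \<bullet> L (axis i 1)))" for i :: 'n
  have U: "real_polynomial_function (U i)" for i
    unfolding U_def using g P
    by (intro real_polynomial_function.intros(4)) (auto simp: real_polynomial_function_eq)
  have "(LINT x:K|lborel. \<Sum>i\<in>UNIV. frechet_derivative (U i) (at x) (axis i 1)) =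
      (\<Sum>i\<in>UNIV. LINT x:K|lborel. frechet_derivative (U i) (at x) (axis i 1))"
    unfolding set_lebesgue_integral_def scaleR_sum_right
    using compact continuous_on_frechet_derivative_polynomial[OF U]
    by (intro Bochner_Integration.integral_sum borel_integrable_compact)
  also have "\<dots> = (\<Sum>i\<in>UNIV. \<Sum>F | F facet_of K. (outward_normal K F $ i) * face_int (outward_normal K F) F (U i))"
    by (simp add: integral_directional_derivative[OF U] inner_axis)
  also have "\<dots> = (\<Sum>F | F facet_of K. \<Sum>i\<in>UNIV. (outward_normal K F $ i) * face_int (outward_normal K F) F (U i))"
    by (rule sum.swap)
  also have "\<dots> = (\<Sum>F | F facet_of K. face_int (outward_normal K F) F (\<lambda>x. g x * (P x \<bullet> L (outward_normal K F))))"
  proof (rule sum.cong[OF refl])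
    fix F assume "F \<in> {F. F facet_of K}"
    then have F: "F facet_of K" by simp
    let ?\<nu> = "outward_normal K F"
    have "(\<Sum>i\<in>UNIV. ?\<nu> $ i * face_int ?\<nu> F (U i)) = face_int ?\<nu> F (\<lambda>x. \<Sum>i\<in>UNIV. ?\<nu> $ i * U i x)"
      by (subst face_int_sum[OF F])
         (auto simp: face_int_cmult intro!: continuous_intros continuous_on_real_polynomial_function[OF U])
    also have "(\<lambda>x. \<Sum>i\<in>UNIV. ?\<nu> $ i * U i x) = (\<lambda>x. g x * (P x \<bullet> L ?\<nu>))"
      by (subst linear_sum_axis[OF L]) (simp add: U_def inner_sum_right sum_distrib_left mult_ac)
    finally show "(\<Sum>i\<in>UNIV. ?\<nu> $ i * face_int ?\<nu> F (U i)) = face_int ?\<nu> F (\<lambda>x. g x * (P x \<bullet> L ?\<nu>))" .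
  qed
  finally show ?thesis
    by (simp add: U_def)
qed

end

section \<open>Transport by the velocity field\<close>

text \<open>The cross product is orthogonal to both \<open>bhat\<close> and
  \<open>grad_perp\<close>, and the full gradient is a combination of these two.\<close>

lemma velocity_orthogonal_grad: "velocity D \<phi> K x \<bullet> grad D \<phi> K x = 0"
proof -
  have "velocity D \<phi> K x \<bullet> bhat D K x = 0" "velocity D \<phi> K x \<bullet> grad_perp D \<phi> K x = 0"
    unfolding velocity_def
    by (simp_all add: dot_cross_self cross_mult_left)
  moreover have "grad D \<phi> K x = grad_perp D \<phi> K x + (bhat D K x \<bullet> grad D \<phi> K x) *\<^sub>R bhat D K x"
    by (simp add: grad_perp_def)
  ultimately show ?thesis
    by (metis inner_add_right inner_scaleR_right mult_zero_right add_0)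
qed

context fem_mesh
begin

lemma set_integrable_cell:
  fixes f :: "real^'n \<Rightarrow> real"
  assumes "K \<in> cells M" "continuous_on K f"
  shows "set_integrable lborel K f"
  using assms solid_polytope.compact[OF solid_cell] by (intro set_integrable_lborel_compact)

lemma vol_int_add:
  assumes "\<And>K. K \<in> cells M \<Longrightarrow> continuous_on K (f K)" "\<And>K. K \<in> cells M \<Longrightarrow> continuous_on K (g K)"
  shows "vol_int M (\<lambda>K x. f K x + g K x) = vol_int M f + vol_int M g"
  unfolding vol_int_def sum.distrib[symmetric]
  by (intro sum.cong refl set_integral_add(2) set_integrable_cell assms)

lemma vol_int_lincomb:
  assumes \<phi>: "\<phi> \<in> L2_space M p" and e: "\<And>j. j < m \<Longrightarrow> e j \<in> L2_space M q"
  shows "vol_int M (\<lambda>K x. \<phi> K x * lincomb m e z K x) = (\<Sum>j<m. z j * vol_int M (\<lambda>K x. \<phi> K x * e j K x))"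
proof -
  have "(LINT x:K|lborel. \<phi> K x * lincomb m e z K x) = (\<Sum>j<m. z j * (LINT x:K|lborel. \<phi> K x * e j K x))"
    if K: "K \<in> cells M" for K
  proof -
    have "set_integrable lborel K (\<lambda>x. z j * (\<phi> K x * e j K x))" if "j < m" for j
      using L2_space_polynomial[OF \<phi> K] L2_space_polynomial[OF e[OF that] K] K
      by (intro set_integrable_cell continuous_intros continuous_on_real_polynomial_function)
    then have "(\<Sum>j<m. LINT x:K|lborel. z j * (\<phi> K x * e j K x)) =
        (LINT x:K|lborel. (\<Sum>j<m. z j * (\<phi> K x * e j K x)))"
      unfolding set_lebesgue_integral_def set_integrable_def scaleR_sum_right
      by (intro Bochner_Integration.integral_sum[symmetric]) auto
    then show ?thesis
      by (simp add: lincomb_def sum_distrib_left mult_ac)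
  qed
  then show ?thesis
    unfolding vol_int_def by (simp add: sum_distrib_left) (rule sum.swap)
qed

text \<open>\<open>v K\<close> is known to be polynomial only on the closed cell, so its derivatives
  are controlled only in the interior. The frontier of a convex set is null, and \<open>P\<close>
  supplies a field defined everywhere for the divergence theorem.\<close>

lemma transport_integral_cell:
  fixes D :: "'n medium"
  assumes emb: "linear (emb D)" and K: "K \<in> cells M"
    and \<phi>: "real_polynomial_function (\<phi> K)" and w: "real_polynomial_function (w K)"
    and P: "polynomial_function P" "\<And>x. x \<in> K \<Longrightarrow> v K x = P x"
    and div: "divergence_free M D v"
    and orth: "\<And>x. v K x \<bullet> grad D \<phi> K x = 0"
  shows "(LINT x:K|lborel. \<phi> K x * (v K x \<bullet> grad D w K x)) =
    (\<Sum>F | F facet_of K. face_int (outward_normal K F) F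
       (\<lambda>x. \<phi> K x * w K x * (P x \<bullet> emb D (outward_normal K F))))"
proof -
  interpret solid_polytope K
    using K by (rule solid_cell)
  define U where "U i = (\<lambda>y. (\<phi> K y * w K y) * (P y \<bullet> emb D (axis i 1)))" for i
  have U: "real_polynomial_function (U i)" for i
    unfolding U_def using \<phi> w P(1)
    by (intro real_polynomial_function.intros(4)) (auto simp: real_polynomial_function_eq)
  have diff: "\<phi> K differentiable (at x)" "w K differentiable (at x)" "P differentiable (at x)" for x
    using \<phi> w P(1) differentiable_at_real_polynomial_function differentiable_at_polynomial_function by blast+
  have pointwise: "\<phi> K x * (v K x \<bullet> grad D w K x) = (\<Sum>i\<in>UNIV. frechet_derivative (U i) (at x) (axis i 1))"
    if x: "x \<in> interior K" for x
  proof -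
    have xK: "x \<in> K"
      using x interior_subset by blast
    let ?d = "\<lambda>f i. frechet_derivative f (at x) (axis i 1)"
    let ?a = "\<lambda>i. emb D (axis i 1)"
    have "(v K has_derivative frechet_derivative P (at x)) (at x)"
      by (rule has_derivative_transform_within_open[of P _ x UNIV "interior K"])
         (use diff(3) x in \<open>auto simp: frechet_derivative_works[symmetric] P(2)[OF subsetD[OF interior_subset]]\<close>)
    then have "frechet_derivative (v K) (at x) = frechet_derivative P (at x)"
      by (rule frechet_derivative_at[symmetric])
    moreover have "(\<Sum>i\<in>UNIV. ?d (v K) i \<bullet> ?a i) = 0"
      using div K x by (simp add: divergence_free_def divergence_def)
    ultimately have div0: "(\<Sum>i\<in>UNIV. ?d P i \<bullet> ?a i) = 0"
      by (simp only:)
    \<comment> \<open>After summation over \<open>i\<close>, the derivative of \<open>P\<close>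
      gives the divergence and that of \<open>\<phi>\<close> gives
      \<open>P \<bullet> grad \<phi>\<close>; both vanish, and only the derivative of
      \<open>w\<close> remains.\<close>
    have "?d (U i) i = \<phi> K x * w K x * (?d P i \<bullet> ?a i) +
        (\<phi> K x * ?d (w K) i + ?d (\<phi> K) i * w K x) * (P x \<bullet> ?a i)" for i
      unfolding U_def
      by (subst frechet_derivative_mult_real)
         (auto simp: frechet_derivative_mult_real frechet_derivative_inner_const diff
           intro!: differentiable_mult differentiable_inner)
    then have "(\<Sum>i\<in>UNIV. ?d (U i) i) = \<phi> K x * w K x * (\<Sum>i\<in>UNIV. ?d P i \<bullet> ?a i) +
        (\<phi> K x * (P x \<bullet> grad D w K x) + w K x * (P x \<bullet> grad D \<phi> K x))"
      by (simp add: grad_def inner_sum_right sum_distrib_left sum.distrib[symmetric] algebra_simps)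
    also have "\<dots> = \<phi> K x * (v K x \<bullet> grad D w K x)"
      using div0 orth[of x] P(2)[OF xK] by simp
    finally show ?thesis by simp
  qed
  have "frontier K \<in> null_sets lborel"
    using convex by (intro null_sets_lborel_if_negligible negligible_convex_frontier) auto
  then have AE: "AE x in lborel. x \<notin> frontier K"
    by (rule AE_not_in)
  have "(LINT x:K|lborel. \<phi> K x * (v K x \<bullet> grad D w K x)) =
      (LINT x:K|lborel. \<phi> K x * (P x \<bullet> grad D w K x))"
    using P(2) compact by (intro set_lebesgue_integral_cong) (auto intro: borel_compact)
  also have "\<dots> = (LINT x:K|lborel. \<Sum>i\<in>UNIV. frechet_derivative (U i) (at x) (axis i 1))"
    unfolding set_lebesgue_integral_def
  proof (rule integral_cong_AE)
    have "continuous_on K (\<lambda>x. \<phi> K x * (P x \<bullet> grad D w K x))"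
      unfolding grad_def using P(1)
      by (intro continuous_intros continuous_on_real_polynomial_function[OF \<phi>]
          continuous_on_frechet_derivative_polynomial[OF w] continuous_on_polymonial_function)
    then show "(\<lambda>x. indicator K x *\<^sub>R (\<phi> K x * (P x \<bullet> grad D w K x))) \<in> borel_measurable lborel"
      by (intro borel_measurable_integrable borel_integrable_compact compact)
    show "(\<lambda>x. indicator K x *\<^sub>R (\<Sum>i\<in>UNIV. frechet_derivative (U i) (at x) (axis i 1))) \<in> borel_measurable lborel"
      by (intro borel_measurable_integrable borel_integrable_compact compact continuous_intros
          continuous_on_frechet_derivative_polynomial[OF U])
    show "AE x in lborel. indicator K x *\<^sub>R (\<phi> K x * (P x \<bullet> grad D w K x)) =
        indicator K x *\<^sub>R (\<Sum>i\<in>UNIV. frechet_derivative (U i) (at x) (axis i 1))"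
      using AE
    proof eventually_elim
      case (elim x)
      then have "x \<in> K \<Longrightarrow> x \<in> interior K"
        using closure_subset by (auto simp: frontier_def)
      then show ?case
        using pointwise[of x] P(2)[of x] by (cases "x \<in> K") auto
    qed
  qed
  also have "\<dots> = (\<Sum>F | F facet_of K. face_int (outward_normal K F) F
       (\<lambda>x. (\<phi> K x * w K x) * (P x \<bullet> emb D (outward_normal K F))))"
    unfolding U_def using emb P(1) \<phi> w
    by (intro divergence_theorem real_polynomial_function.intros(4))
  finally show ?thesis .
qed

text \<open>The two cells at an internal face contribute with opposite normals, while
  \<open>\<phi>\<close> and the normal component of \<open>v\<close> are single-valued there; hence
  only the jump of \<open>w\<close> appears. Boundary faces drop out because \<open>\<phi>\<close>
  vanishes on them.\<close>

lemma transport_integral: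
  fixes D :: "'n medium"
  assumes emb: "linear (emb D)"
    and \<phi>: "\<phi> \<in> H1_space M p" and w: "w \<in> L2_space M q"
    and v: "v \<in> H_Div M D" and div: "divergence_free M D v"
    and orth: "\<And>K x. v K x \<bullet> grad D \<phi> K x = 0"
  shows "vol_int M (\<lambda>K x. \<phi> K x * (v K x \<bullet> grad D w K x)) =
    (\<Sum>(K, F, K', s)\<in>\<Gamma> M. face_int (fnormal M F) F
       (\<lambda>x. \<phi> K x * (w K x - w K' (x + s)) * (v K x \<bullet> emb D (fnormal M F))))"
proof -
  have \<phi>2: "\<phi> \<in> L2_space M p"
    using \<phi> H1_space_subset_L2_space by blast
  have "\<exists>P. K \<in> cells M \<longrightarrow> polynomial_function P \<and> (\<forall>x\<in>K. v K x = P x)" for K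
    using v by (auto simp: H_Div_def)
  then obtain P where P: "\<And>K. K \<in> cells M \<Longrightarrow> polynomial_function (P K)"
      "\<And>K x. K \<in> cells M \<Longrightarrow> x \<in> K \<Longrightarrow> v K x = P K x"
    by metis
  define J where "J K F = face_int (outward_normal K F) F
      (\<lambda>x. \<phi> K x * w K x * (P K x \<bullet> emb D (outward_normal K F)))" for K F
  have cont: "continuous_on UNIV (\<phi> K)" "continuous_on UNIV (w K)" "continuous_on UNIV (P K)"
    if "K \<in> cells M" for K
    using L2_space_polynomial[OF \<phi>2 that] L2_space_polynomial[OF w that] P(1)[OF that]
    by (auto intro: continuous_on_real_polynomial_function continuous_on_polymonial_function)
  have "vol_int M (\<lambda>K x. \<phi> K x * (v K x \<bullet> grad D w K x)) = (\<Sum>K\<in>cells M. \<Sum>F | F facet_of K. J K F)"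
    unfolding vol_int_def J_def
    using L2_space_polynomial[OF \<phi>2] L2_space_polynomial[OF w] P emb div orth
    by (intro sum.cong refl transport_integral_cell) auto
  also have "\<dots> = (\<Sum>(K, F, K', s)\<in>\<Gamma> M. J K F + J K' (translate s F))"
  proof (rule sum_faces_eq_sum_\<Gamma>)
    fix K F assume b: "(K, F) \<in> boundary_faces M"
    then have "K \<in> cells M" and F: "F facet_of K"
      by (auto simp: boundary_faces_def outer_faces_def)
    then interpret solid_polytope K
      using solid_cell by blast
    have "J K F = face_int (outward_normal K F) F (\<lambda>x. 0)"
      unfolding J_def by (rule face_int_cong[OF F]) (simp add: L2_space_boundary[OF \<phi>2 b])
    then show "J K F = 0"
      by (simp add: face_int_zero)
  qed
  also have "\<dots> = (\<Sum>(K, F, K', s)\<in>\<Gamma> M. face_int (fnormal M F) F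
       (\<lambda>x. \<phi> K x * (w K x - w K' (x + s)) * (v K x \<bullet> emb D (fnormal M F))))"
  proof (intro sum.cong refl, safe)
    fix K F K' s
    assume "(K, F, K', s) \<in> \<Gamma> M"
    then have i: "(K, F, K', s) \<in> interfaces M" and n: "fnormal M F = outward_normal K F"
      by (auto simp: \<Gamma>_def)
    note KF = interface[OF i]
    interpret solid_polytope K
      using solid_cell[OF KF(1)] .
    let ?\<nu> = "outward_normal K F"
    let ?G = "\<lambda>x. \<phi> K' (x + s) * w K' (x + s) * (P K' (x + s) \<bullet> emb D ?\<nu>)"
    have cont_shift: "continuous_on UNIV (\<lambda>x. f (x + s))" if "continuous_on UNIV f"
      for f :: "real^'n \<Rightarrow> 'c::topological_space"
      by (rule continuous_on_compose2[OF that]) (auto intro!: continuous_intros)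
    have "J K' (translate s F) = face_int ?\<nu> F
        (\<lambda>x. \<phi> K' (x + s) * w K' (x + s) * (P K' (x + s) \<bullet> emb D (- ?\<nu>)))"
      unfolding J_def
      by (subst face_int_translate[OF solid_cell[OF KF(1)] KF(3) solid_cell[OF KF(2)] KF(4) interface_normal[OF i]])
         (auto simp: interface_normal[OF i] intro!: continuous_intros cont KF(2))
    also have "\<dots> = - face_int ?\<nu> F ?G"
      using face_int_cmult[of ?\<nu> F "-1" ?G] by (simp add: linear_neg[OF emb])
    finally have "J K F + J K' (translate s F) = face_int ?\<nu> F
        (\<lambda>x. \<phi> K x * w K x * (P K x \<bullet> emb D ?\<nu>) - ?G x)"
      unfolding J_def
      by (subst face_int_diff[OF KF(3)])
         (auto intro!: continuous_intros cont KF cont_shift)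
    also have "\<dots> = face_int ?\<nu> F (\<lambda>x. \<phi> K x * (w K x - w K' (x + s)) * (v K x \<bullet> emb D ?\<nu>))"
    proof (rule face_int_cong[OF KF(3)])
      fix x assume x: "x \<in> F"
      have xK: "x \<in> K" "x + s \<in> K'"
        using facet_subset[OF KF(3)] x facet_of_imp_subset[OF KF(4)] mem_translateI[OF x] by blast+
      have "v K x \<bullet> emb D (fnormal M F) = v K' (x + s) \<bullet> emb D (fnormal M F)"
        using v i x by (auto simp: H_Div_def)
      then show "\<phi> K x * w K x * (P K x \<bullet> emb D ?\<nu>) - ?G x =
          \<phi> K x * (w K x - w K' (x + s)) * (v K x \<bullet> emb D ?\<nu>)"
        using H1_space_continuous[OF \<phi> i x] P(2)[OF KF(1) xK(1)] P(2)[OF KF(2) xK(2)]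
        by (simp add: n algebra_simps)
    qed
    finally show "J K F + J K' (translate s F) = face_int (fnormal M F) F
        (\<lambda>x. \<phi> K x * (w K x - w K' (x + s)) * (v K x \<bullet> emb D (fnormal M F)))"
      by (simp add: n)
  qed
  finally show ?thesis .
qed

end

section \<open>Conservation of quadratic invariants\<close>

text \<open>Cooper's argument. Linearity is stated through the first \<open>m\<close> components
  because \<open>RK_step\<close> controls no others; symmetry transfers it to the first
  argument.\<close>

lemma symplectic_RK_preserves_quadratic:
  fixes q :: "(nat \<Rightarrow> real) \<Rightarrow> (nat \<Rightarrow> real) \<Rightarrow> real"
  assumes sym: "\<And>y z. q y z = q z y"
    and lin: "\<And>y z. q y z = (\<Sum>k<m. z k * G y k)"
    and symplectic: "symplectic_RK s a b"
    and step: "RK_step m s a b h f X c c'"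
    and orth: "\<And>i. i < s \<Longrightarrow> q (X i) (f (X i)) = 0"
  shows "q c' c' = q c c"
proof -
  have expand: "q y z' = q y z + h * (\<Sum>j<s. r j * q y (f (X j)))"
    if "\<And>k. k < m \<Longrightarrow> z' k = z k + h * (\<Sum>j<s. r j * f (X j) k)" for y z z' r
  proof -
    have "q y z' = (\<Sum>k<m. z k * G y k) + (\<Sum>k<m. \<Sum>j<s. h * (r j * (f (X j) k * G y k)))"
      by (simp add: lin that sum.distrib[symmetric] distrib_right sum_distrib_left sum_distrib_right mult.assoc)
    also have "(\<Sum>k<m. \<Sum>j<s. h * (r j * (f (X j) k * G y k))) =
        (\<Sum>j<s. \<Sum>k<m. h * (r j * (f (X j) k * G y k)))"
      by (rule sum.swap)
    finally show ?thesis
      by (simp add: lin sum_distrib_left)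
  qed
  define A where "A i j = q (f (X i)) (f (X j))" for i j
  have A_sym: "A i j = A j i" for i j
    by (simp add: A_def sym)
  \<comment> \<open>The starting value is the stage value minus its increments, and orthogonality
    removes the stage value. The coefficients \<open>a\<close> enter here.\<close>
  have stage: "q c (f (X i)) = - h * (\<Sum>j<s. a i j * A i j)" if i: "i < s" for i
  proof -
    have "q (f (X i)) (X i) = q (f (X i)) c + h * (\<Sum>j<s. a i j * A i j)"
      unfolding A_def using step i by (intro expand) (simp add: RK_step_def)
    then show ?thesis
      using orth[OF i] sym[of "f (X i)" "X i"] sym[of c "f (X i)"] by simp
  qed
  have step_c: "c' k = c k + h * (\<Sum>j<s. b j * f (X j) k)" if "k < m" for k
    using step that by (simp add: RK_step_def)
  have "q c' c' = q c' c + h * (\<Sum>i<s. b i * q c' (f (X i)))"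
    by (rule expand[OF step_c])
  also have "q c' c = q c c + h * (\<Sum>i<s. b i * q c (f (X i)))"
    unfolding sym[of c' c] by (rule expand[OF step_c])
  also have "(\<Sum>i<s. b i * q c' (f (X i))) =
      (\<Sum>i<s. b i * q c (f (X i))) + h * (\<Sum>i<s. \<Sum>j<s. b i * b j * A i j)"
  proof -
    have "q c' (f (X i)) = q c (f (X i)) + h * (\<Sum>j<s. b j * A i j)" for i
      unfolding sym[of _ "f (X i)"] A_def by (rule expand[OF step_c])
    then show ?thesis
      by (simp add: distrib_left sum.distrib sum_distrib_left mult_ac)
  qed
  also have "(\<Sum>i<s. \<Sum>j<s. b i * b j * A i j) =
      (\<Sum>i<s. \<Sum>j<s. b i * a i j * A i j) + (\<Sum>i<s. \<Sum>j<s. b j * a j i * A i j)"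
    using symplectic by (simp add: symplectic_RK_def sum.distrib[symmetric] distrib_right[symmetric])
  \<comment> \<open>Since \<open>A\<close> is symmetric, relabelling makes both halves equal. The
    quadratic term is then twice the sum that the two first-order terms contribute with the opposite
    sign.\<close>
  also have "(\<Sum>i<s. \<Sum>j<s. b j * a j i * A i j) = (\<Sum>i<s. \<Sum>j<s. b i * a i j * A i j)"
    by (subst sum.swap) (simp add: A_sym)
  also have "(\<Sum>i<s. b i * q c (f (X i))) = - h * (\<Sum>i<s. \<Sum>j<s. b i * a i j * A i j)"
    by (simp add: stage sum_distrib_left sum_negf mult_ac)
  finally show ?thesis
    by (simp add: algebra_simps)
qed

section \<open>Energy form and orthogonality for the discretized system\<close>

context fem_mesh
begin

text \<open>The boundary integral of the potential equation drops out because every test function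
  vanishes on the Dirichlet faces, which are all of \<open>boundary_faces\<close>.\<close>

lemma energy_form:
  assumes "\<psi> \<in> potential_space M p N" and u: "solves_potential_eq M D (potential_space M p N) u \<phi>"
  shows "vol_int M (\<lambda>K x. rho D K x / (norm (mag D K x))\<^sup>2 * (grad_perp D \<psi> K x \<bullet> grad_perp D \<phi> K x)) =
    vol_int M (\<lambda>K x. \<psi> K x * u K x)"
proof -
  have \<psi>: "\<psi> \<in> L2_space M p"
    using assms(1) H1_space_subset_L2_space by (auto simp: potential_space_def)
  have "face_int (outward_normal K F) F (\<lambda>x. \<psi> K x * (rho D K x / (norm (mag D K x))\<^sup>2) *
      (grad_perp D \<phi> K x \<bullet> emb D (outward_normal K F))) = 0"
    if b: "(K, F) \<in> boundary_faces M" for K F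
  proof -
    have K: "K \<in> cells M" and F: "F facet_of K"
      using b by (auto simp: boundary_faces_def outer_faces_def)
    interpret solid_polytope K
      using solid_cell[OF K] .
    have "face_int (outward_normal K F) F (\<lambda>x. \<psi> K x * (rho D K x / (norm (mag D K x))\<^sup>2) *
      (grad_perp D \<phi> K x \<bullet> emb D (outward_normal K F))) = face_int (outward_normal K F) F (\<lambda>x. 0)"
      by (rule face_int_cong[OF F]) (simp add: L2_space_boundary[OF \<psi> b])
    then show ?thesis
      by (simp add: face_int_zero)
  qed
  then have "(\<Sum>(K, F)\<in>boundary_faces M. face_int (outward_normal K F) F (\<lambda>x.
        \<psi> K x * (rho D K x / (norm (mag D K x))\<^sup>2) *
        (grad_perp D \<phi> K x \<bullet> emb D (outward_normal K F)))) = 0"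
    by (intro sum.neutral) auto
  then show ?thesis
    using u assms(1) by (simp add: solves_potential_eq_def)
qed

lemma vol_int_vorticity_split:
  fixes D :: "'n medium"
  assumes \<phi>: "\<phi> \<in> L2_space M p" and w: "w \<in> L2_space M q" and wt: "wt \<in> L2_space M q"
    and v: "v \<in> H_Div M D"
  shows "vol_int M (\<lambda>K x. \<phi> K x * (wt K x + v K x \<bullet> grad D w K x)) =
    vol_int M (\<lambda>K x. \<phi> K x * wt K x) + vol_int M (\<lambda>K x. \<phi> K x * (v K x \<bullet> grad D w K x))"
  unfolding distrib_left
proof (rule vol_int_add)
  fix K assume K: "K \<in> cells M"
  obtain P where P: "polynomial_function P" "\<forall>x\<in>K. v K x = P x"
    using v K by (auto simp: H_Div_def)
  note poly = L2_space_polynomial[OF \<phi> K] L2_space_polynomial[OF w K] L2_space_polynomial[OF wt K]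
  show "continuous_on K (\<lambda>x. \<phi> K x * wt K x)"
    by (intro continuous_intros continuous_on_real_polynomial_function poly)
  have "continuous_on K (v K)"
    using continuous_on_polymonial_function[OF P(1)] P(2) by (metis continuous_on_cong)
  then show "continuous_on K (\<lambda>x. \<phi> K x * (v K x \<bullet> grad D w K x))"
    unfolding grad_def
    by (intro continuous_intros continuous_on_real_polynomial_function[OF poly(1)]
        continuous_on_frechet_derivative_polynomial[OF poly(2)])
qed

text \<open>\<open>p \<le> q\<close> makes \<open>\<phi>\<close> an admissible test function, and
  the face terms of its transport integral contain only jumps of the continuous
  \<open>w\<close>.\<close>

lemma cg_vorticity_orthogonal:
  fixes D :: "'n medium"
  assumes emb: "linear (emb D)"
    and \<phi>: "\<phi> \<in> H1_space M p" and pq: "p \<le> q"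
    and w: "w \<in> H1_space M q" and wt: "wt \<in> H1_space M q"
    and v: "velocity D \<phi> \<in> H_Div M D" and div: "divergence_free M D (velocity D \<phi>)"
    and eq: "cg_vorticity_eq M D (H1_space M q) (velocity D \<phi>) w wt"
  shows "vol_int M (\<lambda>K x. \<phi> K x * wt K x) = 0"
proof -
  have L2: "\<phi> \<in> L2_space M p" "w \<in> L2_space M q" "wt \<in> L2_space M q"
    using \<phi> w wt H1_space_subset_L2_space by blast+
  have "face_int (fnormal M F) F (\<lambda>x. \<phi> K x * (w K x - w K' (x + s)) *
      (velocity D \<phi> K x \<bullet> emb D (fnormal M F))) = 0" if g: "(K, F, K', s) \<in> \<Gamma> M" for K F K' s
  proof -
    have i: "(K, F, K', s) \<in> interfaces M" and n: "fnormal M F = outward_normal K F"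
      using g by (auto simp: \<Gamma>_def)
    interpret solid_polytope K
      using solid_cell[OF interface(1)[OF i]] .
    have "face_int (fnormal M F) F (\<lambda>x. \<phi> K x * (w K x - w K' (x + s)) *
        (velocity D \<phi> K x \<bullet> emb D (fnormal M F))) = face_int (fnormal M F) F (\<lambda>x. 0)"
      unfolding n
      by (rule face_int_cong[OF interface(3)[OF i]]) (simp add: H1_space_continuous[OF w i])
    then show ?thesis
      by (simp add: face_int_zero)
  qed
  then have "vol_int M (\<lambda>K x. \<phi> K x * (velocity D \<phi> K x \<bullet> grad D w K x)) = 0"
    unfolding transport_integral[OF emb \<phi> L2(2) v div velocity_orthogonal_grad]
    by (intro sum.neutral) auto
  moreover have "\<phi> \<in> H1_space M q"
    using \<phi> H1_space_mono[OF pq] by blast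
  ultimately show ?thesis
    using eq vol_int_vorticity_split[OF L2 v] by (simp add: cg_vorticity_eq_def)
qed

text \<open>For the continuous \<open>\<phi>\<close> the average is its value and the upwind term
  disappears whatever \<open>\<delta>\<close> is, so the face terms of the scheme are exactly those
  of the transport integral.\<close>

lemma dg_vorticity_orthogonal:
  fixes D :: "'n medium"
  assumes emb: "linear (emb D)"
    and \<phi>: "\<phi> \<in> H1_space M p" and pq: "p \<le> q"
    and w: "w \<in> L2_space M q" and wt: "wt \<in> L2_space M q"
    and v: "velocity D \<phi> \<in> H_Div M D" and div: "divergence_free M D (velocity D \<phi>)"
    and eq: "dg_vorticity_eq M D (L2_space M q) \<delta> (velocity D \<phi>) w wt"
  shows "vol_int M (\<lambda>K x. \<phi> K x * wt K x) = 0"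
proof -
  let ?v = "velocity D \<phi>"
  have \<phi>2: "\<phi> \<in> L2_space M p" "\<phi> \<in> L2_space M q"
    using \<phi> H1_space_subset_L2_space H1_space_mono[OF pq] by blast+
  have "face_int (fnormal M F) F (\<lambda>x. \<phi> K x * (w K x - w K' (x + s)) * (?v K x \<bullet> emb D (fnormal M F))) =
      face_int (fnormal M F) F (\<lambda>x.
        let vn = ?v K x \<bullet> emb D (fnormal M F);
            avg_\<eta> = (\<phi> K x + \<phi> K' (x + s)) / 2;
            jump_\<eta> = \<phi> K x - \<phi> K' (x + s);
            jump_w = w K x - w K' (x + s)
        in vn * avg_\<eta> * jump_w - \<delta> * \<bar>vn\<bar> * jump_\<eta> * jump_w)"
    if g: "(K, F, K', s) \<in> \<Gamma> M" for K F K' s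
  proof -
    have i: "(K, F, K', s) \<in> interfaces M" and n: "fnormal M F = outward_normal K F"
      using g by (auto simp: \<Gamma>_def)
    interpret solid_polytope K
      using solid_cell[OF interface(1)[OF i]] .
    show ?thesis
      unfolding n
      by (rule face_int_cong[OF interface(3)[OF i]])
         (simp add: Let_def H1_space_continuous[OF \<phi> i, symmetric])
  qed
  then have "vol_int M (\<lambda>K x. \<phi> K x * (?v K x \<bullet> grad D w K x)) =
      (\<Sum>(K, F, K', s)\<in>\<Gamma> M. face_int (fnormal M F) F (\<lambda>x.
        let vn = ?v K x \<bullet> emb D (fnormal M F);
            avg_\<eta> = (\<phi> K x + \<phi> K' (x + s)) / 2;
            jump_\<eta> = \<phi> K x - \<phi> K' (x + s);
            jump_w = w K x - w K' (x + s)
        in vn * avg_\<eta> * jump_w - \<delta> * \<bar>vn\<bar> * jump_\<eta> * jump_w))"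
    unfolding transport_integral[OF emb \<phi> w v div velocity_orthogonal_grad]
    by (intro sum.cong refl) auto
  moreover have "vol_int M (\<lambda>K x. \<phi> K x * (wt K x + ?v K x \<bullet> grad D w K x)) -
      (\<Sum>(K, F, K', s)\<in>\<Gamma> M. face_int (fnormal M F) F (\<lambda>x.
        let vn = ?v K x \<bullet> emb D (fnormal M F);
            avg_\<eta> = (\<phi> K x + \<phi> K' (x + s)) / 2;
            jump_\<eta> = \<phi> K x - \<phi> K' (x + s);
            jump_w = w K x - w K' (x + s)
        in vn * avg_\<eta> * jump_w - \<delta> * \<bar>vn\<bar> * jump_\<eta> * jump_w)) = 0"
    using eq \<phi>2(2) unfolding dg_vorticity_eq_def by blast
  ultimately show ?thesis
    using vol_int_vorticity_split[OF \<phi>2(1) w wt v] by linarith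
qed

end

theorem theorem3p6:
  fixes \<Omega> :: "(real^'n) set"
    and M :: "('n::finite) mesh"
    and D :: "'n medium"
    and p pt m s :: nat
    and N :: "('n, real) pw \<Rightarrow> real"
    and W :: "('n, real) pw set"
    and pot :: "('n, real) pw \<Rightarrow> ('n, real) pw"
    and e :: "nat \<Rightarrow> ('n, real) pw"
    and f :: "(nat \<Rightarrow> real) \<Rightarrow> nat \<Rightarrow> real"
    and a :: "nat \<Rightarrow> nat \<Rightarrow> real" and b :: "nat \<Rightarrow> real"
    and dt :: "nat \<Rightarrow> real"
    and c :: "nat \<Rightarrow> nat \<Rightarrow> real"
    and X :: "nat \<Rightarrow> nat \<Rightarrow> nat \<Rightarrow> real"
    and w \<phi> :: "nat \<Rightarrow> ('n, real) pw"
  assumes dim: "CARD('n) = 2 \<or> CARD('n) = 3"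
    and mesh: "fe_mesh \<Omega> M"
    and data: "medium_on M D"
    and normalization: "linear_functional_on (H1_space M p) N"
    and uniqueness: "pos_definite_on M D (potential_space M p N)"
    and potential: "\<forall>u\<in>W. solves_potential_eq M D (potential_space M p N) u (pot u)"
    and degrees: "p \<le> pt"
    and basis: "is_basis W m e"
    and vorticity:
      "(W = H1_space M pt \<and>
          (\<forall>y. cg_vorticity_eq M D W (velocity D (pot (lincomb m e y)))
                 (lincomb m e y) (lincomb m e (f y)))) \<or>
       (W = L2_space M pt \<and>
          (\<exists>\<delta>. 0 \<le> \<delta> \<and> \<delta> \<le> 1/2 \<and>
            (\<forall>y. dg_vorticity_eq M D W \<delta> (velocity D (pot (lincomb m e y)))
                   (lincomb m e y) (lincomb m e (f y)))))"
    and symplectic: "symplectic_RK s a b"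
    and step_size: "\<forall>n. dt n > 0"
    and steps: "\<forall>n. RK_step m s a b (dt n) f (X n) (c n) (c (Suc n))"
    and H_Div: "\<forall>n. \<forall>i<s. velocity D (pot (lincomb m e (X n i))) \<in> H_Div M D"
    and div_free: "\<forall>n. \<forall>i<s. divergence_free M D (velocity D (pot (lincomb m e (X n i))))"
    and iterates: "\<forall>n. w n = lincomb m e (c n)"
    and potentials: "\<forall>n. \<phi> n = pot (w n)"
  shows "\<forall>n. energy M D (\<phi> (Suc n)) = energy M D (\<phi> n)"
proof
  fix n
  interpret fem_mesh \<Omega> M
    by unfold_locales (rule mesh)
  have emb: "linear (emb D)"
    using data by (simp add: medium_on_def)
  let ?u = "lincomb m e"
  have W_L2: "W \<subseteq> L2_space M pt"
    using vorticity H1_space_subset_L2_space by blast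
  have e: "e j \<in> W" if "j < m" for j
    using basis that by (simp add: is_basis_def)
  have u: "?u y \<in> W" for y
    using vorticity e lincomb_in_H1_space[of m e M pt y] lincomb_in_L2_space[of m e M pt y] by blast
  have pot: "solves_potential_eq M D (potential_space M p N) (?u y) (pot (?u y))" for y
    using potential u by blast
  then have V: "pot (?u y) \<in> potential_space M p N" for y
    by (simp add: solves_potential_eq_def)
  then have H1: "pot (?u y) \<in> H1_space M p" for y
    by (simp add: potential_space_def)
  then have L2: "pot (?u y) \<in> L2_space M p" for y
    using H1_space_subset_L2_space by blast
  define q where "q y z = vol_int M (\<lambda>K x. pot (?u y) K x * ?u z K x)" for y z
  \<comment> \<open>This expression shows the symmetry of \<open>q\<close>; the defining one shows
    linearity in \<open>z\<close>, which enters there only through \<open>lincomb\<close>.\<close>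
  have form: "q y z = vol_int M (\<lambda>K x. rho D K x / (norm (mag D K x))\<^sup>2 *
      (grad_perp D (pot (?u y)) K x \<bullet> grad_perp D (pot (?u z)) K x))" for y z
    unfolding q_def by (rule energy_form[OF V pot, symmetric])
  have energy: "energy M D (pot (?u y)) = 1/2 * q y y" for y
    by (simp add: energy_def form power2_norm_eq_inner)
  have sym: "q y z = q z y" for y z
    by (simp add: form inner_commute)
  have lin: "q y z = (\<Sum>k<m. z k * vol_int M (\<lambda>K x. pot (?u y) K x * e k K x))" for y z
    unfolding q_def using e W_L2 by (intro vol_int_lincomb[OF L2]) blast
  \<comment> \<open>The conditions on the velocity are assumed at the stage values, which is exactly
    where the method evaluates \<open>f\<close>.\<close>
  have orth: "q (X n i) (f (X n i)) = 0" if i: "i < s" for i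
  proof -
    let ?y = "X n i"
    have v: "velocity D (pot (?u ?y)) \<in> H_Div M D" "divergence_free M D (velocity D (pot (?u ?y)))"
      using H_Div div_free i by blast+
    from vorticity show ?thesis
    proof (elim disjE conjE exE)
      assume "W = H1_space M pt"
        and "\<forall>y. cg_vorticity_eq M D W (velocity D (pot (?u y))) (?u y) (?u (f y))"
      then show ?thesis
        unfolding q_def using u v by (intro cg_vorticity_orthogonal[OF emb H1 degrees]) auto
    next
      fix \<delta> :: real
      assume "W = L2_space M pt"
        and "\<forall>y. dg_vorticity_eq M D W \<delta> (velocity D (pot (?u y))) (?u y) (?u (f y))"
      then show ?thesis
        unfolding q_def using u v by (intro dg_vorticity_orthogonal[OF emb H1 degrees]) auto
    qed
  qed
  have "q (c (Suc n)) (c (Suc n)) = q (c n) (c n)"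
    by (rule symplectic_RK_preserves_quadratic[OF sym lin symplectic steps[rule_format] orth])
  then show "energy M D (\<phi> (Suc n)) = energy M D (\<phi> n)"
    by (simp add: potentials iterates energy)
qed

end
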